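(* Let $d\in\mathbb N$, $\beta>0$ and $a>0$. (a) Setting $p^{\mathrm{CMF}}(\beta,\alpha)=+\infty$ for $\alpha>0$, the function $p^{\mathrm{CMF}}(\beta,\cdot)$ is a closed convex function on $\mathbb R$. (b) For $\alpha<0$ the pressure $p^{\mathrm{CMF}}(\beta,\alpha)$ is smooth with respect to $\alpha$. In particular, $$\frac{\mathrm dp^{\mathrm{CMF}}}{\mathrm d\alpha}=D(\xi^{\mathrm{CMF}})=\frac{W_0(a\beta\bar q^{(\alpha)})}{a\beta\bar q^{(\alpha)}}D(q^{(\alpha)}).$$ (c) In the thermodynamic limit, $$\varrho_{\rm c}^{\mathrm{CMF}}(d):=\lim_{\alpha\uparrow0}\frac{\mathrm d}{\mathrm d\alpha}p^{\mathrm{CMF}}(\beta,\alpha)=\begin{cases}+\infty,&d=1,2,\\[4pt]\dfrac{W_0(a\beta\bar q^{(0)})}{a\beta\bar q^{(0)}}\,\varrho_{\rm c}(d),&d\ge3.\end{cases}$$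
   Context: $|\Lambda_N|=(2N)^d$ for $N\in\mathbb N=\{1,2,\dots\}$; for $\alpha\le0$, $q_k^{(\alpha)}=\frac{e^{\beta k\alpha}}{(4\pi\beta)^{d/2}k^{1+d/2}}$, $q^{(\alpha)}=(q^{(\alpha)}_k)_{k\in\mathbb N}$, $\bar q^{(\alpha)}=\sum_{k\in\mathbb N}q_k^{(\alpha)}$, $D(x)=\sum_{k\ge1}kx_k$. Let $(\mathcal N_k)_{k\in\mathbb N}$ be independent Poisson random variables, $\mathcal N_k$ with parameter $|\Lambda_N|q_k^{(\alpha)}$; $\nu_{N,\alpha}$ is the law on $\ell_1(\mathbb R_+)$ (nonnegative summable sequences) of $(\mathcal N_k/|\Lambda_N|)_{k\in\mathbb N}$. For $\alpha\le0$, $$p^{\mathrm{CMF}}(\beta,\alpha)=\lim_{N\to\infty}\frac1{\beta|\Lambda_N|}\log\Big(e^{|\Lambda_N|\bar q^{(\alpha)}}\,\mathbb E_{\nu_{N,\alpha}}\big[e^{-\beta|\Lambda_N|H^{\mathrm{CMF}}}\big]\Big),\qquad H^{\mathrm{CMF}}(x)=\frac a2\Big(\sum_{k\ge1}x_k\Big)^2.$$ $\xi^{\mathrm{CMF}}$ is the unique minimiser over $\ell_1(\mathbb R_+)$ of $I_\alpha+H^{\mathrm{CMF}}$, where $I_\alpha(x)=\sum_k\frac{x_k}\beta\big(\log\frac{x_k}{q_k^{(\alpha)}}-1\big)+\bar q^{(\alpha)}/\beta$ ($0\log 0=0$). $W_0$ is the Lambert function on $[0,\infty)$: $W_0(x)e^{W_0(x)}=x$,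 $W_0(x)\ge0$. $\varrho_{\rm c}(d)=(4\pi\beta)^{-d/2}\zeta(d/2)$ for $d\ge3$ is the ideal-gas critical density. A closed convex function is a convex function with closed epigraph (lower semicontinuous). *)

theory Defs
  imports "HOL-Probability.Probability"
begin

text \<open>
  Sequences indexed by \<open>k = 1, 2, \<dots>\<close> are functions \<^typ>\<open>nat \<Rightarrow> real\<close> of which only the
  values on \<^term>\<open>{1::nat..}\<close> matter; elements of \<open>\<ell>\<^sub>1(\<real>\<^sub>+)\<close> are extensional on that set, so that
  equality of functions is equality of sequences.
\<close>

definition l1_nonneg :: "(nat \<Rightarrow> real) set" where
  "l1_nonneg = {x \<in> {1..} \<rightarrow>\<^sub>E {0..}. x summable_on {1..}}"

definition volume :: "nat \<Rightarrow> nat \<Rightarrow> real" where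
  "volume d N = (2 * real N) ^ d"

definition q :: "nat \<Rightarrow> real \<Rightarrow> real \<Rightarrow> nat \<Rightarrow> real" where
  "q d \<beta> \<alpha> k =
     exp (\<beta> * real k * \<alpha>) / ((4 * pi * \<beta>) powr (real d / 2) * real k powr (1 + real d / 2))"

definition qbar :: "nat \<Rightarrow> real \<Rightarrow> real \<Rightarrow> real" where
  "qbar d \<beta> \<alpha> = (\<Sum>\<^sub>\<infinity>k\<in>{1..}. q d \<beta> \<alpha> k)"

text \<open>The particle density may be infinite, hence the extended reals.\<close>

definition D :: "(nat \<Rightarrow> real) \<Rightarrow> ereal" where
  "D x = (\<Sum>\<^sub>\<infinity>k\<in>{1..}. ereal (real k * x k))"

text \<open>
  The law of \<open>(\<N>\<^sub>k / |\<Lambda>\<^sub>N|)\<^sub>k\<close> is formed on the space of all real sequences and then restricted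
  to \<open>\<ell>\<^sub>1(\<real>\<^sub>+)\<close>, a measurable set of full measure. The trace of the product sigma-algebra is the
  Borel sigma-algebra of the \<open>\<ell>\<^sub>1\<close> norm. All Poisson parameters are positive when \<open>N \<ge> 1\<close>.
\<close>

definition poisson_product :: "nat \<Rightarrow> real \<Rightarrow> real \<Rightarrow> nat \<Rightarrow> (nat \<Rightarrow> nat) measure" where
  "poisson_product d \<beta> \<alpha> N =
     (\<Pi>\<^sub>M k\<in>{1..}. measure_pmf (poisson_pmf (volume d N * q d \<beta> \<alpha> k)))"

definition nu :: "nat \<Rightarrow> real \<Rightarrow> real \<Rightarrow> nat \<Rightarrow> (nat \<Rightarrow> real) measure" where
  "nu d \<beta> \<alpha> N =
     restrict_space
       (distr (poisson_product d \<beta> \<alpha> N) (\<Pi>\<^sub>M k\<in>{1..}. borel)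
          (\<lambda>n. \<lambda>k\<in>{1..}. real (n k) / volume d N))
       l1_nonneg"

definition H_CMF :: "real \<Rightarrow> (nat \<Rightarrow> real) \<Rightarrow> real" where
  "H_CMF a x = a / 2 * (\<Sum>\<^sub>\<infinity>k\<in>{1..}. x k)\<^sup>2"

definition finite_pressure_CMF :: "nat \<Rightarrow> real \<Rightarrow> real \<Rightarrow> real \<Rightarrow> nat \<Rightarrow> real" where
  "finite_pressure_CMF d \<beta> a \<alpha> N =
     1 / (\<beta> * volume d N) *
     ln (exp (volume d N * qbar d \<beta> \<alpha>) *
         (\<integral>x. exp (- \<beta> * volume d N * H_CMF a x) \<partial>nu d \<beta> \<alpha> N))"

text \<open>Meaningful for \<open>\<alpha> \<le> 0\<close> only.\<close>

definition p_CMF :: "nat \<Rightarrow> real \<Rightarrow> real \<Rightarrow> real \<Rightarrow> real" where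
  "p_CMF d \<beta> a \<alpha> = lim (\<lambda>N. finite_pressure_CMF d \<beta> a \<alpha> N)"

definition p_CMF_ext :: "nat \<Rightarrow> real \<Rightarrow> real \<Rightarrow> real \<Rightarrow> ereal" where
  "p_CMF_ext d \<beta> a \<alpha> = (if \<alpha> > 0 then \<infinity> else ereal (p_CMF d \<beta> a \<alpha>))"

text \<open>
  The rate function takes values in \<open>[0, \<infinity>]\<close> on \<open>\<ell>\<^sub>1(\<real>\<^sub>+)\<close>. The negative parts of the summands
  are bounded by \<open>q\<^sub>k / \<beta>\<close> and thus summable, so the sum always exists in \<open>(-\<infinity>, \<infinity>]\<close>.
  The convention \<open>0 log 0 = 0\<close> holds because the logarithm is multiplied by \<open>x\<^sub>k = 0\<close>.
\<close>

definition rate_I :: "nat \<Rightarrow> real \<Rightarrow> real \<Rightarrow> (nat \<Rightarrow> real) \<Rightarrow> ereal" where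
  "rate_I d \<beta> \<alpha> x =
     (\<Sum>\<^sub>\<infinity>k\<in>{1..}. ereal (x k / \<beta> * (ln (x k / q d \<beta> \<alpha> k) - 1))) + ereal (qbar d \<beta> \<alpha> / \<beta>)"

definition is_minimiser_CMF ::
    "nat \<Rightarrow> real \<Rightarrow> real \<Rightarrow> real \<Rightarrow> (nat \<Rightarrow> real) \<Rightarrow> bool" where
  "is_minimiser_CMF d \<beta> a \<alpha> x \<longleftrightarrow>
     is_arg_min (\<lambda>y. rate_I d \<beta> \<alpha> y + ereal (H_CMF a y)) (\<lambda>y. y \<in> l1_nonneg) x"

definition xi_CMF :: "nat \<Rightarrow> real \<Rightarrow> real \<Rightarrow> real \<Rightarrow> nat \<Rightarrow> real" where
  "xi_CMF d \<beta> a \<alpha> = (THE x. is_minimiser_CMF d \<beta> a \<alpha> x)"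

definition W0 :: "real \<Rightarrow> real" where
  "W0 x = (THE w. 0 \<le> w \<and> w * exp w = x)"

text \<open>The series is \<open>\<zeta>(d/2)\<close>, convergent for \<open>d \<ge> 3\<close>.\<close>

definition rho_c :: "nat \<Rightarrow> real \<Rightarrow> real" where
  "rho_c d \<beta> =
     (4 * pi * \<beta>) powr (- real d / 2) * (\<Sum>\<^sub>\<infinity>k\<in>{1..}. 1 / real k powr (real d / 2))"

definition epigraph_ereal :: "(real \<Rightarrow> ereal) \<Rightarrow> (real \<times> real) set" where
  "epigraph_ereal f = {(x, t). f x \<le> ereal t}"

definition closed_convex_function :: "(real \<Rightarrow> ereal) \<Rightarrow> bool" where
  "closed_convex_function f \<longleftrightarrow> convex (epigraph_ereal f) \<and> closed (epigraph_ereal f)"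

text \<open>Intended for open \<open>S\<close>.\<close>

definition smooth_on :: "real set \<Rightarrow> (real \<Rightarrow> real) \<Rightarrow> bool" where
  "smooth_on S f \<longleftrightarrow> (\<forall>n. (deriv ^^ n) f differentiable_on S)"

end

theory Submission
  imports Defs
begin

text \<open>
  Why the theorem holds. The interaction sees only the total number \<open>M\<close> of loops,
  and \<open>M\<close>, a sum of independent Poisson variables, is again Poisson, with parameter
  \<open>V * qbar\<close> where \<open>V\<close> is the volume. So the partition function is the one-dimensional sum
  \<open>Z = (\<Sum>m. (V * qbar) ^ m / m! * exp (- b * m\<^sup>2 / (2 * V)))\<close> with \<open>b = a * \<beta>\<close>
  (\<open>integral_nu\<close>). Write \<open>qbar = t * exp (b * t)\<close>, that is, \<open>t = W / b\<close> with
  \<open>W = W0 (b * qbar)\<close>. Completing the square turns \<open>Z\<close> into \<open>exp (V * (t + b * t\<^sup>2 / 2))\<close>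
  times the expectation of \<open>exp (- b * (M' - V * t)\<^sup>2 / (2 * V))\<close> for a Poisson variable \<open>M'\<close>
  with parameter \<open>V * t\<close>. That expectation is at most 1, and by Jensen's inequality at least
  \<open>exp (- b * t / 2)\<close>, because \<open>M'\<close> has variance \<open>V * t\<close>. Hence
  \<open>p = (W + W\<^sup>2 / 2) / (a * \<beta>\<^sup>2)\<close> for all \<open>\<alpha> \<le> 0\<close> (\<open>p_CMF_eq\<close>).

  Everything else is read off from this formula. The derivative is
  \<open>exp (- W) * (\<Sum>k. k * q k)\<close>, and \<open>exp (- W) = W / (b * qbar)\<close>. All functions met when
  differentiating further lie in the algebra generated by constants, the moments
  \<open>\<Sum>k. (\<beta> * k) ^ n * q k\<close>, \<open>exp (- W)\<close> and \<open>1 / (1 + W)\<close>; it is closed under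
  differentiation, so the pressure is smooth. Convexity comes from a variational formula:
  the pressure is a supremum of increasing affine functions of \<open>ln qbar\<close>, and
  \<open>ln qbar\<close> is convex by Hoelder's inequality. Closedness is continuity on \<open>\<alpha> \<le> 0\<close>, where
  the series \<open>qbar\<close> converges uniformly.

  The minimiser is \<open>\<xi> = exp (- W) * q\<close>: relative to it, \<open>I + H\<close> is a constant plus
  a sum of relative entropies plus \<open>a / 2\<close> times the square of the deviation of the total mass
  from \<open>t\<close> (\<open>rate_plus_H_eq\<close>), so \<open>\<xi>\<close> is the only minimiser. At \<open>\<alpha> = 0\<close> the
  density \<open>\<Sum>k. k * q k\<close> is a multiple of \<open>\<Sum>k. 1 / k powr (d / 2)\<close>, finite exactly for
  \<open>d \<ge> 3\<close>, which decides the limit of the derivative.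
\<close>

section \<open>The Lambert function on the nonnegative half-line\<close>

lemma exp_mult_expanding:
  fixes v w :: real
  assumes "0 \<le> v" "v \<le> w"
  shows "w - v \<le> w * exp w - v * exp v"
proof -
  have "w - v \<le> (w - v) * exp w"
    using assms mult_left_mono[of 1 "exp w" "w - v"] by simp
  also have "\<dots> \<le> w * exp w - v * exp v"
    using assms mult_left_mono[of "exp v" "exp w" v] by (simp add: algebra_simps)
  finally show ?thesis .
qed

lemma W0_ex1:
  assumes "0 \<le> x"
  shows "\<exists>!w. 0 \<le> w \<and> w * exp w = (x::real)"
proof -
  have "x \<le> x * exp x"
    using assms mult_left_mono[of 1 "exp x" x] by simp
  then have "\<exists>w\<ge>0. w \<le> x \<and> w * exp w = x"
    using assms by (intro IVT') (auto intro!: continuous_intros)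
  then obtain w where "0 \<le> w" "w * exp w = x"
    by blast
  moreover have "v = w" if "0 \<le> v" "0 \<le> w" "v * exp v = x" "w * exp w = x" for v w :: real
    using exp_mult_expanding[of v w] exp_mult_expanding[of w v] that by linarith
  ultimately show ?thesis by blast
qed

lemma
  assumes "0 \<le> x"
  shows W0_nonneg: "0 \<le> W0 x" and W0_exp: "W0 x * exp (W0 x) = x"
  using theI'[OF W0_ex1[OF assms]] by (auto simp: W0_def)

lemma W0_pos:
  assumes "0 < x"
  shows "0 < W0 x"
  using W0_nonneg[of x] W0_exp[of x] assms by (cases "W0 x = 0") auto

lemma W0_div_self:
  assumes "0 < x"
  shows "W0 x / x = exp (- W0 x)"
  using W0_exp[of x] assms W0_pos[OF assms] by (simp add: exp_minus field_simps)

text \<open>Since \<open>w e\<^sup>w\<close> expands distances on the nonnegative half-line, its inverse contracts them.\<close>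

lemma W0_lipschitz:
  assumes "0 \<le> x" "0 \<le> y"
  shows "\<bar>W0 x - W0 y\<bar> \<le> \<bar>x - y\<bar>"
  using exp_mult_expanding[of "W0 x" "W0 y"] exp_mult_expanding[of "W0 y" "W0 x"]
    W0_nonneg[OF assms(1)] W0_nonneg[OF assms(2)] W0_exp[OF assms(1)] W0_exp[OF assms(2)]
  by linarith

lemma continuous_on_W0: "continuous_on {0..} W0"
  unfolding continuous_on_iff dist_real_def
  using W0_lipschitz by (metis atLeast_iff order_le_less_trans)

lemma DERIV_W0:
  assumes "0 < x"
  shows "DERIV W0 x :> exp (- W0 x) / (1 + W0 x)"
proof -
  have "isCont W0 x"
    using continuous_on_interior[OF continuous_on_W0] assms by simp
  moreover have "DERIV (\<lambda>w. w * exp w) (W0 x) :> exp (W0 x) * (1 + W0 x)"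
    by (auto intro!: derivative_eq_intros simp: algebra_simps)
  ultimately have "DERIV W0 x :> inverse (exp (W0 x) * (1 + W0 x))"
    using assms W0_pos[OF assms] W0_exp
    by (intro DERIV_inverse_function[where f = "\<lambda>w. w * exp w" and a = 0 and b = "x + 1"]) auto
  then show ?thesis
    by (simp add: exp_minus field_simps)
qed

section \<open>The weights and their moments\<close>

lemma q_0_index [simp]: "q d \<beta> \<alpha> 0 = 0"
  by (simp add: q_def)

lemma q_nonneg: "0 \<le> q d \<beta> \<alpha> k"
  by (simp add: q_def)

lemma q_pos:
  assumes "0 < \<beta>" "1 \<le> k"
  shows "0 < q d \<beta> \<alpha> k"
  using assms by (simp add: q_def)

lemma q_eq: "q d \<beta> \<alpha> k = exp (\<beta> * real k * \<alpha>) * q d \<beta> 0 k"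
  by (simp add: q_def)

definition moment :: "nat \<Rightarrow> real \<Rightarrow> nat \<Rightarrow> real \<Rightarrow> real" where
  "moment d \<beta> n \<alpha> = (\<Sum>\<^sub>\<infinity>k\<in>{1..}. (\<beta> * real k) ^ n * q d \<beta> \<alpha> k)"

lemma qbar_eq_moment: "qbar d \<beta> = moment d \<beta> 0"
  by (simp add: fun_eq_iff qbar_def moment_def)

context
  fixes d :: nat and \<beta> :: real
  assumes d: "1 \<le> d" and \<beta>: "0 < \<beta>"
begin

lemma summable_on_q0: "q d \<beta> 0 summable_on {1..}"
proof -
  have "summable (\<lambda>k. real k powr (- (1 + real d / 2)))"
    using d by (simp add: summable_real_powr_iff)
  then have "summable (\<lambda>k. 1 / (4 * pi * \<beta>) powr (real d / 2) * real k powr (- (1 + real d / 2)))"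
    by (rule summable_mult)
  also have "(\<lambda>k. 1 / (4 * pi * \<beta>) powr (real d / 2) * real k powr (- (1 + real d / 2))) = q d \<beta> 0"
    by (simp only: q_def powr_minus divide_inverse fun_eq_iff inverse_mult_distrib) simp
  finally have "summable (q d \<beta> 0)" .
  then have "q d \<beta> 0 summable_on UNIV"
    by (simp add: summable_on_UNIV_nonneg_real_iff q_nonneg)
  then show ?thesis
    by (rule summable_on_subset_banach) simp
qed

text \<open>
  One exponential factor pays for any power of \<open>k\<close>, because \<open>y\<^sup>n / n! \<le> e\<^sup>y\<close>. The bound is
  uniform on a half-line to the left of a negative point, which lets the series be
  differentiated termwise.
\<close>

lemma moment_term_bound:
  assumes "c < 0" "\<alpha> \<le> c"
  shows "(\<beta> * real k) ^ n * q d \<beta> \<alpha> k \<le> fact n / (- c) ^ n * q d \<beta> 0 k"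
proof -
  define y where "y = \<beta> * real k * (- c)"
  have "0 \<le> y"
    using \<beta> assms(1) mult_nonneg_nonneg[of "\<beta> * real k" "- c"] by (simp add: y_def)
  have "y ^ n / fact n \<le> (\<Sum>i<Suc n. y ^ i / fact i)"
    using \<open>0 \<le> y\<close> by (intro member_le_sum) auto
  also have "\<dots> \<le> (\<Sum>i. y ^ i / fact i)"
    using \<open>0 \<le> y\<close> summable_exp[of y]
    by (intro sum_le_suminf) (auto simp: divide_inverse mult.commute)
  also have "\<dots> = exp y"
    by (simp add: exp_def divide_inverse mult.commute scaleR_conv_of_real)
  finally have "y ^ n * exp (- y) \<le> fact n"
    by (simp add: exp_minus divide_simps mult.commute)
  moreover have "exp (\<beta> * real k * \<alpha>) \<le> exp (- y)"
    using \<beta> assms by (auto simp: y_def intro!: mult_left_mono)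
  ultimately have "y ^ n * exp (\<beta> * real k * \<alpha>) \<le> fact n"
    using \<open>0 \<le> y\<close> by (meson mult_left_mono order_trans zero_le_power)
  then have "(\<beta> * real k) ^ n * exp (\<beta> * real k * \<alpha>) \<le> fact n / (- c) ^ n"
    unfolding y_def power_mult_distrib[of "\<beta> * real k"] using assms
    by (simp add: pos_le_divide_eq mult_ac)
  then show ?thesis
    using mult_right_mono[OF _ q_nonneg[of d \<beta> 0 k]] by (subst q_eq) (metis mult.assoc)
qed

lemma summable_on_moment:
  assumes "\<alpha> < 0"
  shows "(\<lambda>k. (\<beta> * real k) ^ n * q d \<beta> \<alpha> k) summable_on {1..}"
  using moment_term_bound[OF assms order_refl, of _ n] \<beta>
  by (intro summable_on_comparison_test[OF summable_on_cmult_right[OF summable_on_q0,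
        of "fact n / (- \<alpha>) ^ n"]]) (auto simp: q_nonneg)

lemma q_le_q0:
  assumes "\<alpha> \<le> 0"
  shows "q d \<beta> \<alpha> k \<le> q d \<beta> 0 k"
  using assms \<beta> by (subst q_eq) (auto intro!: mult_left_le_one_le simp: q_nonneg mult_nonneg_nonpos)

lemma summable_on_q:
  assumes "\<alpha> \<le> 0"
  shows "q d \<beta> \<alpha> summable_on {1..}"
  by (rule summable_on_comparison_test[OF summable_on_q0]) (auto simp: q_nonneg q_le_q0[OF assms])

lemma has_sum_qbar:
  assumes "\<alpha> \<le> 0"
  shows "(q d \<beta> \<alpha> has_sum qbar d \<beta> \<alpha>) {1..}"
  using summable_on_q[OF assms] by (simp add: qbar_def)

lemma qbar_pos:
  assumes "\<alpha> \<le> 0"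
  shows "0 < qbar d \<beta> \<alpha>"
proof -
  have "sum (q d \<beta> \<alpha>) {1} \<le> qbar d \<beta> \<alpha>"
    unfolding qbar_def
    by (rule finite_sum_le_infsum[OF summable_on_q[OF assms]]) (auto simp: q_nonneg)
  then show ?thesis
    using q_pos[OF \<beta>, of 1 d \<alpha>] by simp
qed

lemma DERIV_moment:
  assumes "\<alpha> < 0"
  shows "DERIV (moment d \<beta> n) \<alpha> :> moment d \<beta> (Suc n) \<alpha>"
proof -
  \<comment> \<open>Any point between \<open>\<alpha>\<close> and \<open>0\<close> serves: the bounds are uniform to the left of it.\<close>
  define c where "c = \<alpha> / 2"
  have c: "c < 0" "\<alpha> < c"
    using assms by (auto simp: c_def)
  define f where "f m \<alpha> k = (\<beta> * real k) ^ m * q d \<beta> \<alpha> k" for m \<alpha> k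
  have f0: "f m \<alpha> 0 = 0" for m \<alpha>
    by (simp add: f_def)
  have summ: "(\<lambda>k. f m \<alpha> k) sums moment d \<beta> m \<alpha>" if "\<alpha> \<in> {..<c}" for m \<alpha>
  proof -
    have "(f m \<alpha> has_sum moment d \<beta> m \<alpha>) {1..}"
      using summable_on_moment[of \<alpha> m] that c
      by (simp add: moment_def f_def[abs_def] del: One_nat_def)
    then have "(f m \<alpha> has_sum moment d \<beta> m \<alpha>) UNIV"
      by (rule has_sum_cong_neutral[THEN iffD1, rotated -1]) (auto simp: f0 not_le)
    then show ?thesis by (rule has_sum_imp_sums)
  qed
  have "summable (\<lambda>k. fact (Suc n) / (- c) ^ Suc n * q d \<beta> 0 k)"
  proof -
    have "(q d \<beta> 0 has_sum qbar d \<beta> 0) UNIV"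
      using has_sum_qbar[of 0]
      by (intro has_sum_cong_neutral[THEN iffD1, rotated -1, OF has_sum_qbar[of 0]])
        (auto simp: not_le)
    then show ?thesis
      by (intro summable_mult) (auto dest: has_sum_imp_sums sums_summable)
  qed
  then have unif: "uniform_limit {..<c} (\<lambda>m \<alpha>. \<Sum>k<m. f (Suc n) \<alpha> k)
      (\<lambda>\<alpha>. \<Sum>k. f (Suc n) \<alpha> k) sequentially"
    by (rule Weierstrass_m_test[rotated])
      (use moment_term_bound[OF c(1), of _ _ "Suc n"] \<beta> in
        \<open>auto simp: f_def q_nonneg abs_mult simp del: power_Suc\<close>)
  have der: "((\<lambda>\<alpha>. f n \<alpha> k) has_field_derivative f (Suc n) x k) (at x within {..<c})" for k x
  proof -
    have f_eq: "f m \<alpha> k = (\<beta> * real k) ^ m * q d \<beta> 0 k * exp (\<beta> * real k * \<alpha>)" for m \<alpha>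
      unfolding f_def by (subst q_eq) (simp only: mult_ac)
    have "((\<lambda>\<alpha>. exp (\<beta> * real k * \<alpha>)) has_field_derivative
        exp (\<beta> * real k * x) * (\<beta> * real k)) (at x within {..<c})"
      by (auto intro!: derivative_eq_intros)
    from DERIV_cmult[OF this, of "(\<beta> * real k) ^ n * q d \<beta> 0 k"] show ?thesis
      by (simp add: f_eq mult_ac)
  qed
  have "\<exists>g. \<forall>x\<in>{..<c}. (\<lambda>k. f n x k) sums g x \<and>
      (g has_field_derivative (\<Sum>k. f (Suc n) x k)) (at x within {..<c})"
    using c summ[of \<alpha> n] by (intro has_field_derivative_series[OF _ der unif, of \<alpha>]) 
      (auto simp: sums_iff)
  then obtain g where g: "\<And>x. x < c \<Longrightarrow> (\<lambda>k. f n x k) sums g x"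
      "\<And>x. x < c \<Longrightarrow> (g has_field_derivative (\<Sum>k. f (Suc n) x k)) (at x within {..<c})"
    by auto
  have "(g has_field_derivative (\<Sum>k. f (Suc n) \<alpha> k)) (at \<alpha>)"
    using g(2)[of \<alpha>] c by (simp add: at_within_open[of \<alpha> "{..<c}"])
  moreover have "(\<Sum>k. f (Suc n) \<alpha> k) = moment d \<beta> (Suc n) \<alpha>"
    using summ[of \<alpha> "Suc n"] c by (simp add: sums_iff)
  moreover have "moment d \<beta> n x = g x" if "x < c" for x
    using g(1)[OF that] summ[of x n] that by (simp add: sums_iff)
  then have "\<forall>\<^sub>F x in nhds \<alpha>. moment d \<beta> n x = g x"
    using eventually_nhds_in_open[of "{..<c}" \<alpha>] c by (auto elim: eventually_mono)
  ultimately show ?thesis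
    by (simp add: DERIV_cong_ev)
qed

end

section \<open>Superposition of independent Poisson variables\<close>

lemma (in prob_space) distr_add_poisson:
  fixes X Y :: "'a \<Rightarrow> nat"
  assumes pos: "0 < l" "0 < m"
    and indep: "indep_var (count_space UNIV) X (count_space UNIV) Y"
    and X: "distr M (count_space UNIV) X = measure_pmf (poisson_pmf l)"
    and Y: "distr M (count_space UNIV) Y = measure_pmf (poisson_pmf m)"
  shows "distr M (count_space UNIV) (\<lambda>\<omega>. X \<omega> + Y \<omega>) = measure_pmf (poisson_pmf (l + m))"
proof -
  have rvs [measurable]: "X \<in> measurable M (count_space UNIV)" "Y \<in> measurable M (count_space UNIV)"
    using indep_var_rv1[OF indep] indep_var_rv2[OF indep] by auto
  have pX: "prob (X -` {i} \<inter> space M) = l ^ i / fact i * exp (- l)" for i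
    using arg_cong[OF X, of "\<lambda>M. measure M {i}"] pos
    by (simp add: measure_distr measure_pmf_single)
  have pY: "prob (Y -` {i} \<inter> space M) = m ^ i / fact i * exp (- m)" for i
    using arg_cong[OF Y, of "\<lambda>M. measure M {i}"] pos
    by (simp add: measure_distr measure_pmf_single)
  have joint: "prob ((X -` {i} \<inter> space M) \<inter> (Y -` {j} \<inter> space M)) =
      prob (X -` {i} \<inter> space M) * prob (Y -` {j} \<inter> space M)" for i j
  proof -
    have "(\<lambda>\<omega>. (X \<omega>, Y \<omega>)) -` ({i} \<times> {j}) \<inter> space M =
        (X -` {i} \<inter> space M) \<inter> (Y -` {j} \<inter> space M)"
      by auto
    with indep_varD[OF indep, of "{i}" "{j}"] show ?thesis by simp
  qed
  have "emeasure (distr M (count_space UNIV) (\<lambda>\<omega>. X \<omega> + Y \<omega>)) {n} =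
      emeasure (measure_pmf (poisson_pmf (l + m))) {n}" for n
  proof -
    have "(\<lambda>\<omega>. X \<omega> + Y \<omega>) -` {n} \<inter> space M =
        (\<Union>i\<in>{..n}. (X -` {i} \<inter> space M) \<inter> (Y -` {n - i} \<inter> space M))"
      by auto
    also have "prob \<dots> =
        (\<Sum>i\<le>n. prob ((X -` {i} \<inter> space M) \<inter> (Y -` {n - i} \<inter> space M)))"
      by (intro finite_measure_finite_Union) (auto simp: disjoint_family_on_def)
    also have "\<dots> = (\<Sum>i\<le>n. l ^ i / fact i * exp (- l) * (m ^ (n - i) / fact (n - i) * exp (- m)))"
      by (simp only: joint pX pY)
    also have "\<dots> = (\<Sum>i\<le>n. real (n choose i) * l ^ i * m ^ (n - i)) / fact n * exp (- (l + m))"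
      by (auto simp: sum_divide_distrib sum_distrib_right binomial_fact exp_add exp_diff exp_minus
          divide_simps intro!: sum.cong)
    also have "\<dots> = (l + m) ^ n / fact n * exp (- (l + m))"
      by (simp add: binomial_ring)
    finally show ?thesis
      using pos by (simp add: emeasure_distr emeasure_pmf_single emeasure_eq_measure)
  qed
  then show ?thesis
    by (intro measure_eqI_countable[of _ UNIV]) auto
qed
text \<open>
  Independence of the coordinates of the infinite product, with values in the discrete space, where
  finite sums of coordinates are measurable.
\<close>

lemma poisson_PiM_indep_vars:
  fixes L :: "nat \<Rightarrow> real" and P :: "(nat \<Rightarrow> nat) measure"
  defines "P \<equiv> (\<Pi>\<^sub>M k\<in>{1..}. measure_pmf (poisson_pmf (L k)))"
  shows "prob_space.indep_vars P (\<lambda>_. count_space UNIV) (\<lambda>k \<omega>. \<omega> k) {1..}"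
proof -
  interpret Q: product_prob_space "\<lambda>k. measure_pmf (poisson_pmf (L k))" "{1..}"
    by unfold_locales
  interpret P: prob_space P
    unfolding P_def by (rule prob_space_PiM) (rule measure_pmf.prob_space_axioms)
  have sets_P: "sets P = sets (\<Pi>\<^sub>M k\<in>{1..}. count_space UNIV)"
    unfolding P_def by (intro sets_PiM_cong) auto
  have "distr P (\<Pi>\<^sub>M k\<in>{1..}. count_space UNIV) (\<lambda>\<omega>. \<lambda>k\<in>{1..}. \<omega> k) = distr P P (\<lambda>\<omega>. \<omega>)"
    by (rule distr_cong[OF refl sets_P[symmetric]]) (auto simp: P_def space_PiM)
  also have "\<dots> = P"
    by (rule distr_id)
  also have "\<dots> = (\<Pi>\<^sub>M k\<in>{1..}. distr P (count_space UNIV) (\<lambda>\<omega>. \<omega> k))"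
    unfolding P_def
  proof (rule PiM_cong[OF refl])
    fix k :: nat assume "k \<in> {1..}"
    have "distr (\<Pi>\<^sub>M k\<in>{1..}. measure_pmf (poisson_pmf (L k))) (count_space UNIV) (\<lambda>\<omega>. \<omega> k) =
        distr (\<Pi>\<^sub>M k\<in>{1..}. measure_pmf (poisson_pmf (L k))) (measure_pmf (poisson_pmf (L k))) (\<lambda>\<omega>. \<omega> k)"
      by (intro distr_cong) auto
    then show "measure_pmf (poisson_pmf (L k)) =
        distr (\<Pi>\<^sub>M k\<in>{1..}. measure_pmf (poisson_pmf (L k))) (count_space UNIV) (\<lambda>\<omega>. \<omega> k)"
      using Q.PiM_component[OF \<open>k \<in> {1..}\<close>] by simp
  qed
  finally show ?thesis
    by (subst P.indep_vars_iff_distr_eq_PiM') (auto simp: measurable_cong_sets[OF sets_P refl])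
qed

lemma distr_partial_sum_poisson:
  fixes L :: "nat \<Rightarrow> real"
  assumes pos: "\<And>k. 1 \<le> k \<Longrightarrow> 0 < L k" and "1 \<le> K"
  shows "distr (\<Pi>\<^sub>M k\<in>{1..}. measure_pmf (poisson_pmf (L k))) (count_space UNIV)
      (\<lambda>\<omega>. \<Sum>k=1..K. \<omega> k) = measure_pmf (poisson_pmf (\<Sum>k=1..K. L k))"
proof -
  define P where "P = (\<Pi>\<^sub>M k\<in>{1..}. measure_pmf (poisson_pmf (L k)))"
  interpret Q: product_prob_space "\<lambda>k. measure_pmf (poisson_pmf (L k))" "{1..}"
    by unfold_locales
  interpret P: prob_space P
    unfolding P_def by (rule prob_space_PiM) (rule measure_pmf.prob_space_axioms)
  have single: "distr P (count_space UNIV) (\<lambda>\<omega>. \<omega> k) = measure_pmf (poisson_pmf (L k))"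
    if "1 \<le> k" for k
  proof -
    have "distr P (count_space UNIV) (\<lambda>\<omega>. \<omega> k) = distr P (measure_pmf (poisson_pmf (L k))) (\<lambda>\<omega>. \<omega> k)"
      by (intro distr_cong) auto
    then show ?thesis
      using Q.PiM_component[of k] that by (simp add: P_def)
  qed
  have indep: "P.indep_var (count_space UNIV) (\<lambda>\<omega>. \<Sum>k=1..K. \<omega> k) (count_space UNIV) (\<lambda>\<omega>. \<omega> (Suc K))"
    for K
  proof -
    have "P.indep_var
       (count_space UNIV) ((\<lambda>f. \<Sum>k=1..K. f k) \<circ> (\<lambda>\<omega>. restrict (\<lambda>k. \<omega> k) {1..K}))
       (count_space UNIV) ((\<lambda>f. f (Suc K)) \<circ> (\<lambda>\<omega>. restrict (\<lambda>k. \<omega> k) {Suc K}))"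
      by (rule P.indep_var_compose[OF P.indep_var_restrict[OF
              poisson_PiM_indep_vars[of L, folded P_def]]]) auto
    then show ?thesis
      by (simp add: comp_def)
  qed
  have "distr P (count_space UNIV) (\<lambda>\<omega>. \<Sum>k=1..K. \<omega> k) = measure_pmf (poisson_pmf (\<Sum>k=1..K. L k))"
    using \<open>1 \<le> K\<close>
  proof (induction K rule: dec_induct)
    case base
    show ?case using single[of 1] by simp
  next
    case (step K)
    have "0 < (\<Sum>k=1..K. L k)"
      using step.hyps pos by (intro sum_pos) auto
    from P.distr_add_poisson[OF this pos[of "Suc K"] indep step.IH single] step.hyps
    show ?case by simp
  qed
  then show ?thesis by (simp add: P_def)
qed

text \<open>
  The normalising factor stands on the right to leave a power series in \<open>L\<close>, from which
  continuity in the parameter can be read off.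
\<close>
lemma poisson_expectation:
  fixes g :: "nat \<Rightarrow> real"
  assumes "0 < L" and "\<And>m. \<bar>g m\<bar> \<le> B"
  shows "(\<lambda>m. g m / fact m * L ^ m) sums (exp L * measure_pmf.expectation (poisson_pmf L) g)"
proof -
  have "integrable (measure_pmf (poisson_pmf L)) g"
    by (rule measure_pmf.integrable_const_bound[where B = B]) (use assms(2) in auto)
  then have int: "integrable (count_space UNIV) (\<lambda>m. pmf (poisson_pmf L) m * g m)"
    by (simp add: measure_pmf_eq_density integrable_density)
  have "measure_pmf.expectation (poisson_pmf L) g = (\<integral>m. pmf (poisson_pmf L) m * g m \<partial>count_space UNIV)"
    by (simp add: measure_pmf_eq_density integral_density)
  with sums_integral_count_space_nat[OF int]
  have "(\<lambda>m. pmf (poisson_pmf L) m * g m) sums measure_pmf.expectation (poisson_pmf L) g"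
    by simp
  from sums_mult[OF this, of "exp L"] show ?thesis
    using assms(1) by (simp add: exp_minus field_simps)
qed

section \<open>The partition function of the cycle mean-field model\<close>

lemma has_sum_imp_partial_sums_tendsto:
  fixes f :: "nat \<Rightarrow> 'a::{comm_monoid_add, topological_space}"
  assumes "(f has_sum s) {1..}"
  shows "(\<lambda>K. \<Sum>k=1..K. f k) \<longlonglongrightarrow> s"
proof -
  have "filterlim (\<lambda>K. {1..K}) (finite_subsets_at_top {1::nat..}) sequentially"
    unfolding filterlim_finite_subsets_at_top
  proof safe
    fix X assume X: "finite X" "X \<subseteq> {1::nat..}"
    show "\<forall>\<^sub>F K in sequentially. finite {1..K} \<and> X \<subseteq> {1..K} \<and> {1..K} \<subseteq> {1..}"
      using eventually_ge_at_top[of "Max X"] by eventually_elim (use X in \<open>auto intro: order_trans[OF Max_ge]\<close>)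
  qed
  from filterlim_compose[OF assms[unfolded has_sum_def] this] show ?thesis .
qed

text \<open>
  The value \<open>0\<close> at sequences that are not summable is \<open>exp (- c * \<infinity>\<^sup>2)\<close>. With this convention
  the weight is the pointwise limit of the weights of the partial sums on all nonnegative
  sequences.
\<close>
definition gauss_weight :: "real \<Rightarrow> (nat \<Rightarrow> real) \<Rightarrow> real" where
  "gauss_weight c x = (if x summable_on {1..} then exp (- c * (\<Sum>\<^sub>\<infinity>k\<in>{1..}. x k)\<^sup>2) else 0)"

lemma gauss_weight_tendsto:
  fixes x :: "nat \<Rightarrow> real"
  assumes "0 < c" and nonneg: "\<And>k. 1 \<le> k \<Longrightarrow> 0 \<le> x k"
  shows "(\<lambda>K. exp (- c * (\<Sum>k=1..K. x k)\<^sup>2)) \<longlonglongrightarrow> gauss_weight c x"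
proof (cases "x summable_on {1..}")
  case True
  then show ?thesis
    using has_sum_imp_partial_sums_tendsto[of x "infsum x {1..}"]
    by (auto simp: gauss_weight_def intro!: tendsto_intros)
next
  case False
  have "filterlim (\<lambda>K. \<Sum>k=1..K. x k) at_top sequentially"
    unfolding filterlim_at_top
  proof
    fix Z :: real
    have "\<exists>K. Z \<le> (\<Sum>k=1..K. x k)"
    proof (rule ccontr)
      assume less: "\<not> ?thesis"
      have "x summable_on {1..}"
      proof (rule nonneg_bdd_above_summable_on)
        show "bdd_above (sum x ` {F. F \<subseteq> {1..} \<and> finite F})"
        proof (rule bdd_aboveI2)
          fix F :: "nat set" assume F: "F \<in> {F. F \<subseteq> {1..} \<and> finite F}"
          have "sum x F \<le> (\<Sum>k=1..Max F. x k)"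
            using F nonneg by (intro sum_mono2) auto
          also have "\<dots> \<le> Z"
            using less by (meson linear)
          finally show "sum x F \<le> Z" .
        qed
      qed (use nonneg in auto)
      with False show False by blast
    qed
    then obtain K0 where K0: "Z \<le> (\<Sum>k=1..K0. x k)" by blast
    show "\<forall>\<^sub>F K in sequentially. Z \<le> (\<Sum>k=1..K. x k)"
      using eventually_ge_at_top[of K0]
    proof eventually_elim
      case (elim K)
      have "(\<Sum>k=1..K0. x k) \<le> (\<Sum>k=1..K. x k)"
        using elim nonneg by (intro sum_mono2) auto
      with K0 show ?case by linarith
    qed
  qed
  then have "filterlim (\<lambda>K. c * (\<Sum>k=1..K. x k)\<^sup>2) at_top sequentially"
    using \<open>0 < c\<close> by (intro filterlim_tendsto_pos_mult_at_top[OF tendsto_const] filterlim_pow_at_top) auto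
  then have "(\<lambda>K. exp (- (c * (\<Sum>k=1..K. x k)\<^sup>2))) \<longlonglongrightarrow> 0"
    by (intro filterlim_compose[OF exp_at_bot] filterlim_compose[OF filterlim_uminus_at_bot_at_top])
  with False show ?thesis by (simp add: gauss_weight_def)
qed

text \<open>
  Partial sums have an explicit Poisson law; both sides are limits along them, the left one by
  dominated convergence and the right one by continuity of a power series. On the event that there
  are infinitely many loops, the weights of the partial sums tend to \<open>0\<close>, which is the value
  that \<open>gauss_weight\<close> has there.
\<close>
lemma integral_gauss_weight_poisson:
  fixes L :: "nat \<Rightarrow> real"
  assumes pos: "\<And>k. 1 \<le> k \<Longrightarrow> 0 < L k" and summable: "L summable_on {1..}" and "0 < c" "0 < V"
  defines "P \<equiv> (\<Pi>\<^sub>M k\<in>{1..}. measure_pmf (poisson_pmf (L k)))"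
  defines "S \<equiv> (\<Sum>\<^sub>\<infinity>k\<in>{1..}. L k)"
  shows "exp S * (\<integral>\<omega>. gauss_weight c (\<lambda>k. real (\<omega> k) / V) \<partial>P) =
    (\<Sum>m. exp (- c * (real m / V)\<^sup>2) / fact m * S ^ m)"
proof -
  define g where "g m = exp (- c * (real m / V)\<^sup>2)" for m :: nat
  have g: "0 \<le> g m" "g m \<le> 1" for m
    using \<open>0 < c\<close> by (auto simp: g_def)
  define F where "F z = (\<Sum>m. g m / fact m * z ^ m)" for z :: real
  interpret P: prob_space P
    unfolding P_def by (rule prob_space_PiM) (rule measure_pmf.prob_space_axioms)
  have sum_meas: "(\<lambda>\<omega>. \<Sum>k=1..K. \<omega> k) \<in> measurable P (count_space UNIV)" for K
    unfolding P_def by (rule measurable_sum_nat, rule measurable_compose[OF measurable_component_singleton]) auto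
  have gauss_partial: "exp (- c * (\<Sum>k=1..K. real (\<omega> k) / V)\<^sup>2) = g (\<Sum>k=1..K. \<omega> k)" for K \<omega>
    by (simp add: g_def flip: sum_divide_distrib)
  have lim1: "(\<lambda>K. \<integral>\<omega>. g (\<Sum>k=1..K. \<omega> k) \<partial>P) \<longlonglongrightarrow> (\<integral>\<omega>. gauss_weight c (\<lambda>k. real (\<omega> k) / V) \<partial>P)"
  proof (rule integral_dominated_convergence[where w = "\<lambda>_. 1"])
    have lim: "(\<lambda>K. g (\<Sum>k=1..K. \<omega> k)) \<longlonglongrightarrow> gauss_weight c (\<lambda>k. real (\<omega> k) / V)" for \<omega> :: "nat \<Rightarrow> nat"
      using gauss_weight_tendsto[of c "\<lambda>k. real (\<omega> k) / V"] \<open>0 < c\<close> \<open>0 < V\<close>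
      unfolding gauss_partial by simp
    then show "AE \<omega> in P. (\<lambda>K. g (\<Sum>k=1..K. \<omega> k)) \<longlonglongrightarrow> gauss_weight c (\<lambda>k. real (\<omega> k) / V)"
      by simp
    show meas: "(\<lambda>\<omega>. g (\<Sum>k=1..K. \<omega> k)) \<in> borel_measurable P" for K
      by (rule measurable_compose[OF sum_meas]) simp
    show "(\<lambda>\<omega>. gauss_weight c (\<lambda>k. real (\<omega> k) / V)) \<in> borel_measurable P"
      by (rule borel_measurable_LIMSEQ_real[OF lim meas])
  qed (use g in auto)
  have "(\<lambda>K. exp (- (\<Sum>k=1..K. L k)) * F (\<Sum>k=1..K. L k)) \<longlonglongrightarrow> exp (- S) * F S"
  proof -
    have "isCont F z" for z
      unfolding F_def
    proof (rule isCont_powser)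
      have "summable (\<lambda>m. \<bar>z\<bar> ^ m / fact m + 1 * (\<bar>z\<bar> + 1) ^ m / fact m)"
        using summable_exp[of "\<bar>z\<bar>"] summable_exp[of "\<bar>z\<bar> + 1"]
        by (intro summable_add) (auto simp: divide_inverse mult.commute)
      then show "summable (\<lambda>m. g m / fact m * (\<bar>z\<bar> + 1) ^ m)"
        by (rule summable_comparison_test')
          (use g in \<open>auto simp: abs_mult power_abs add_nonneg_nonneg field_simps
            intro!: order_trans[OF mult_left_le_one_le] \<close>)
    qed auto
    moreover have "(\<lambda>K. \<Sum>k=1..K. L k) \<longlonglongrightarrow> S"
      unfolding S_def using summable by (intro has_sum_imp_partial_sums_tendsto) simp
    ultimately show ?thesis
      by (intro tendsto_intros isCont_tendsto_compose[of _ F])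
  qed
  moreover have "\<forall>\<^sub>F K in sequentially. (\<integral>\<omega>. g (\<Sum>k=1..K. \<omega> k) \<partial>P) =
      exp (- (\<Sum>k=1..K. L k)) * F (\<Sum>k=1..K. L k)"
    using eventually_ge_at_top[of 1]
  proof eventually_elim
    case (elim K)
    define l where "l = (\<Sum>k=1..K. L k)"
    have "0 < l"
      using elim pos by (auto simp: l_def intro!: sum_pos)
    have "(\<integral>\<omega>. g (\<Sum>k=1..K. \<omega> k) \<partial>P) = (\<integral>m. g m \<partial>distr P (count_space UNIV) (\<lambda>\<omega>. \<Sum>k=1..K. \<omega> k))"
      by (rule integral_distr[OF sum_meas, symmetric]) simp
    also have "\<dots> = measure_pmf.expectation (poisson_pmf l) g"
      unfolding P_def l_def by (subst distr_partial_sum_poisson[OF pos elim]) auto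
    also have "F l = exp l * \<dots>"
      unfolding F_def using poisson_expectation[OF \<open>0 < l\<close>, of g 1] g
      by (intro sums_unique[symmetric]) auto
    then have "measure_pmf.expectation (poisson_pmf l) g = exp (- l) * F l"
      by (simp add: exp_minus)
    finally show ?case by (simp add: l_def)
  qed
  ultimately have "(\<lambda>K. \<integral>\<omega>. g (\<Sum>k=1..K. \<omega> k) \<partial>P) \<longlonglongrightarrow> exp (- S) * F S"
    using tendsto_cong by fast
  from LIMSEQ_unique[OF lim1 this] show ?thesis
    by (simp add: F_def g_def exp_minus)
qed

lemma volume_pos: "1 \<le> N \<Longrightarrow> 0 < volume d N"
  by (simp add: volume_def)

text \<open>
  The map to the normalised loop counts carries the Poisson product to \<open>nu\<close>. Measurability of
  \<open>l1_nonneg\<close> comes for free: it is the set where the limit \<open>G\<close> of measurable functions is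
  positive.
\<close>
lemma integral_nu:
  assumes d: "1 \<le> d" and \<beta>: "0 < \<beta>" and a: "0 < a" and "\<alpha> \<le> 0" "1 \<le> N"
  defines "V \<equiv> volume d N"
  shows "exp (V * qbar d \<beta> \<alpha>) * (\<integral>x. exp (- \<beta> * V * H_CMF a x) \<partial>nu d \<beta> \<alpha> N) =
    (\<Sum>m. (V * qbar d \<beta> \<alpha>) ^ m / fact m * exp (- (a * \<beta> / (2 * V)) * (real m)\<^sup>2))"
proof -
  have V: "0 < V"
    using \<open>1 \<le> N\<close> by (simp add: V_def volume_pos)
  define c where "c = \<beta> * V * a / 2"
  have c: "0 < c"
    using V \<beta> a by (simp add: c_def)
  define P where "P = poisson_product d \<beta> \<alpha> N"
  define B where "B = (\<Pi>\<^sub>M k\<in>{1::nat..}. (borel :: real measure))"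
  define T where "T \<omega> = (\<lambda>k\<in>{1..}. real (\<omega> k) / V)" for \<omega> :: "nat \<Rightarrow> nat"
  define G where "G x = indicator l1_nonneg x * exp (- c * (\<Sum>\<^sub>\<infinity>k\<in>{1..}. x k)\<^sup>2)" for x
  have T: "T \<in> measurable P B"
    unfolding T_def B_def P_def poisson_product_def
    by (intro measurable_restrict measurable_compose[OF measurable_component_singleton]) auto
  have nonneg_meas: "{x \<in> space B. \<forall>k\<in>{1..}. 0 \<le> x k} \<in> sets B"
  proof -
    have "{x \<in> space B. 0 \<le> x k} \<in> sets B" if "k \<in> {1..}" for k
    proof -
      have "(\<lambda>x. x k) \<in> borel_measurable B"
        unfolding B_def using that by (rule measurable_component_singleton)
      then show ?thesis
        by (rule borel_measurable_le[OF borel_measurable_const])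
    qed
    then have "(\<Inter>k\<in>{1..}. {x \<in> space B. 0 \<le> x k}) \<in> sets B"
      by (intro sets.countable_INT') auto
    also have "(\<Inter>k\<in>{1..}. {x \<in> space B. 0 \<le> x k}) = {x \<in> space B. \<forall>k\<in>{1..}. 0 \<le> x k}"
      by blast
    finally show ?thesis .
  qed
  have lim: "(\<lambda>K. indicator {x \<in> space B. \<forall>k\<in>{1..}. 0 \<le> x k} x * exp (- c * (\<Sum>k=1..K. x k)\<^sup>2))
      \<longlonglongrightarrow> G x" if "x \<in> space B" for x
  proof (cases "\<forall>k\<in>{1..}. 0 \<le> x k")
    case True
    then have "x \<in> l1_nonneg \<longleftrightarrow> x summable_on {1..}"
      using that by (auto simp: l1_nonneg_def B_def space_PiM PiE_iff)
    with True that gauss_weight_tendsto[OF c, of x] show ?thesis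
      by (auto simp: G_def gauss_weight_def)
  next
    case False
    then show ?thesis
      by (auto simp: G_def l1_nonneg_def PiE_iff indicator_def)
  qed
  have G_meas: "G \<in> borel_measurable B"
  proof (rule borel_measurable_LIMSEQ_real[OF lim])
    fix K
    have "(\<lambda>x. \<Sum>k=1..K. x k) \<in> borel_measurable B"
      unfolding B_def by (intro borel_measurable_sum measurable_component_singleton) auto
    then show "(\<lambda>x. indicator {x \<in> space B. \<forall>k\<in>{1..}. 0 \<le> x k} x * exp (- c * (\<Sum>k=1..K. x k)\<^sup>2))
        \<in> borel_measurable B"
      using nonneg_meas by measurable
  qed auto
  have "{x \<in> space B. 0 < G x} = l1_nonneg \<inter> space B"
    by (auto simp: G_def indicator_def split: if_splits)
  moreover have "{x \<in> space B. 0 < G x} \<in> sets B"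
    using G_meas by measurable
  ultimately have l1_meas: "l1_nonneg \<inter> space B \<in> sets B"
    by simp
  have "(\<integral>x. exp (- \<beta> * V * H_CMF a x) \<partial>nu d \<beta> \<alpha> N) = (\<integral>x. G x \<partial>distr P B T)"
    unfolding nu_def P_def[symmetric] T_def[symmetric] B_def[symmetric] V_def[symmetric]
    using l1_meas by (subst integral_restrict_space) (auto simp: G_def[abs_def] c_def H_CMF_def mult_ac)
  also have "\<dots> = (\<integral>\<omega>. G (T \<omega>) \<partial>P)"
    by (rule integral_distr[OF T G_meas])
  also have "\<dots> = (\<integral>\<omega>. gauss_weight c (\<lambda>k. real (\<omega> k) / V) \<partial>P)"
  proof (rule arg_cong[where f = "integral\<^sup>L P"], rule ext)
    fix \<omega>
    have "T \<omega> summable_on {1..} \<longleftrightarrow> (\<lambda>k. real (\<omega> k) / V) summable_on {1..}"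
      by (rule summable_on_cong) (simp add: T_def)
    moreover have "infsum (T \<omega>) {1..} = (\<Sum>\<^sub>\<infinity>k\<in>{1..}. real (\<omega> k) / V)"
      by (rule infsum_cong) (simp add: T_def)
    moreover have "T \<omega> \<in> l1_nonneg \<longleftrightarrow> T \<omega> summable_on {1..}"
    proof -
      have "T \<omega> \<in> {1..} \<rightarrow>\<^sub>E {0..}"
        using V by (auto simp: T_def)
      then show ?thesis by (simp add: l1_nonneg_def)
    qed
    ultimately show "G (T \<omega>) = gauss_weight c (\<lambda>k. real (\<omega> k) / V)"
      by (simp add: G_def gauss_weight_def indicator_def)
  qed
  finally have int: "(\<integral>x. exp (- \<beta> * V * H_CMF a x) \<partial>nu d \<beta> \<alpha> N) =
      (\<integral>\<omega>. gauss_weight c (\<lambda>k. real (\<omega> k) / V) \<partial>P)" .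
  have S: "(\<Sum>\<^sub>\<infinity>k\<in>{1..}. V * q d \<beta> \<alpha> k) = V * qbar d \<beta> \<alpha>"
    using has_sum_cmult_right[OF has_sum_qbar[OF d \<beta> \<open>\<alpha> \<le> 0\<close>], of V] by (simp add: infsumI)
  have summ: "(\<lambda>k. V * q d \<beta> \<alpha> k) summable_on {1..}"
    using summable_on_q[OF d \<beta> \<open>\<alpha> \<le> 0\<close>] by (rule summable_on_cmult_right)
  have "exp (V * qbar d \<beta> \<alpha>) * (\<integral>\<omega>. gauss_weight c (\<lambda>k. real (\<omega> k) / V) \<partial>P) =
      (\<Sum>m. exp (- c * (real m / V)\<^sup>2) / fact m * (V * qbar d \<beta> \<alpha>) ^ m)"
    using integral_gauss_weight_poisson[OF _ summ c V] q_pos[OF \<beta>] V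
    unfolding S P_def poisson_product_def V_def[symmetric] by simp
  also have "\<dots> = (\<Sum>m. (V * qbar d \<beta> \<alpha>) ^ m / fact m * exp (- (a * \<beta> / (2 * V)) * (real m)\<^sup>2))"
    using V by (intro suminf_cong) (simp add: c_def power2_eq_square field_simps)
  finally show ?thesis
    unfolding int .
qed

section \<open>Laplace asymptotics of the partition function\<close>

text \<open>Up to the factor \<open>exp l\<close>, these are the total mass and the variance of a Poisson law.\<close>
lemma poisson_sum_moments:
  fixes l :: real
  shows "(\<lambda>m. l ^ m / fact m) sums exp l"
    and "(\<lambda>m. l ^ m / fact m * (real m - l)\<^sup>2) sums (l * exp l)"
proof -
  show 0: "(\<lambda>m. l ^ m / fact m) sums exp l"
    using exp_converges[of l] by (simp add: divide_inverse mult.commute)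
  have 1: "(\<lambda>m. l ^ m / fact m * real m) sums (l * exp l)"
  proof -
    have "(\<lambda>m. l ^ Suc m / fact (Suc m) * real (Suc m)) sums (l * exp l)"
      using sums_mult[OF 0, of l] by (simp del: of_nat_Suc)
    then show ?thesis by (subst (asm) sums_Suc_iff) simp
  qed
  have 2: "(\<lambda>m. l ^ m / fact m * (real m * (real m - 1))) sums (l\<^sup>2 * exp l)"
  proof -
    have "l ^ Suc m / fact (Suc m) * (real (Suc m) * (real (Suc m) - 1)) =
        l * (l ^ m / fact m * real m)" for m
    proof -
      have "real (Suc m) - 1 = real m" by simp
      then show ?thesis by (simp del: of_nat_Suc)
    qed
    with sums_mult[OF 1, of l]
    have "(\<lambda>m. l ^ Suc m / fact (Suc m) * (real (Suc m) * (real (Suc m) - 1))) sums (l * (l * exp l))"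
      by simp
    then show ?thesis by (subst (asm) sums_Suc_iff) (simp add: power2_eq_square mult.assoc)
  qed
  have "(\<lambda>m. l ^ m / fact m * (real m * (real m - 1)) + l ^ m / fact m * real m
      + (- 2 * l) * (l ^ m / fact m * real m) + l\<^sup>2 * (l ^ m / fact m))
    sums (l\<^sup>2 * exp l + l * exp l + (- 2 * l) * (l * exp l) + l\<^sup>2 * exp l)"
    by (intro sums_add sums_mult 0 1 2)
  then show "(\<lambda>m. l ^ m / fact m * (real m - l)\<^sup>2) sums (l * exp l)"
    by (simp add: power2_eq_square algebra_simps)
qed

text \<open>
  The exponential tilt by \<open>b * t\<close> centres the weights at \<open>m = V * t\<close>, where
  the summands of \<open>Z\<close> peak, and leaves a Gaussian factor around the mean of a Poisson law.
  This factor is at most \<open>1\<close>, and Jensen's inequality bounds its expectation below in terms of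
  the variance \<open>V * t\<close>, which the coefficient \<open>b / (2 * V)\<close> turns into a bound uniform
  in \<open>V\<close>.
\<close>
lemma partition_sum_bounds:
  fixes b V t :: real
  assumes "0 < b" "0 < V" "0 \<le> t"
  defines "Z \<equiv> (\<Sum>m. (V * (t * exp (b * t))) ^ m / fact m * exp (- (b / (2 * V)) * (real m)\<^sup>2))"
  shows "exp (V * (t + b * t\<^sup>2 / 2) - b * t / 2) \<le> Z" and "Z \<le> exp (V * (t + b * t\<^sup>2 / 2))"
proof -
  define \<kappa> where "\<kappa> = b / (2 * V)"
  have \<kappa>: "0 < \<kappa>"
    using assms by (simp add: \<kappa>_def)
  define w where "w m = (V * t) ^ m / fact m" for m
  have w: "0 \<le> w m" for m
    using assms by (simp add: w_def)
  have w_sums: "w sums exp (V * t)" and var: "(\<lambda>m. w m * (real m - V * t)\<^sup>2) sums (V * t * exp (V * t))"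
    using poisson_sum_moments[of "V * t"] by (simp_all add: w_def[abs_def])
  have pre: "exp (V * (t + b * t\<^sup>2 / 2)) = exp (V * b * t\<^sup>2 / 2) * exp (V * t)"
    by (simp add: algebra_simps flip: exp_add)
  have term_eq: "(V * (t * exp (b * t))) ^ m / fact m * exp (- (b / (2 * V)) * (real m)\<^sup>2) =
      exp (V * b * t\<^sup>2 / 2) * (w m * exp (- \<kappa> * (real m - V * t)\<^sup>2))" for m
  proof -
    have "b * t * real m + - (b / (2 * V)) * (real m)\<^sup>2 = V * b * t\<^sup>2 / 2 + - \<kappa> * (real m - V * t)\<^sup>2"
      using assms by (simp add: \<kappa>_def power2_eq_square field_simps)
    then have "exp (b * t * real m) * exp (- (b / (2 * V)) * (real m)\<^sup>2) =
        exp (V * b * t\<^sup>2 / 2) * exp (- \<kappa> * (real m - V * t)\<^sup>2)"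
      by (simp only: exp_add[symmetric])
    moreover have "exp (b * t) ^ m = exp (b * t * real m)"
      by (simp add: exp_of_nat_mult[symmetric] mult.commute)
    ultimately show ?thesis
      by (simp add: w_def power_mult_distrib)
  qed
  have le_w: "w m * exp (- \<kappa> * (real m - V * t)\<^sup>2) \<le> w m" for m
    using w[of m] \<kappa> by (intro mult_left_le) auto
  have summ: "summable (\<lambda>m. w m * exp (- \<kappa> * (real m - V * t)\<^sup>2))"
    using le_w w by (intro summable_comparison_test'[OF sums_summable[OF w_sums]]) auto
  have Z: "Z = exp (V * b * t\<^sup>2 / 2) * (\<Sum>m. w m * exp (- \<kappa> * (real m - V * t)\<^sup>2))"
    unfolding Z_def term_eq by (rule suminf_mult[OF summ])
  have "(\<Sum>m. w m * exp (- \<kappa> * (real m - V * t)\<^sup>2)) \<le> exp (V * t)"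
    using suminf_le[OF le_w summ sums_summable[OF w_sums]] sums_unique[OF w_sums] by simp
  then show "Z \<le> exp (V * (t + b * t\<^sup>2 / 2))"
    unfolding Z pre by simp
  \<comment> \<open>Jensen's inequality, through the tangent of the exponential at minus \<open>\<kappa>\<close> times the variance.\<close>
  have "(\<lambda>m. exp (- \<kappa> * (V * t)) * ((1 + \<kappa> * (V * t)) * w m - \<kappa> * (w m * (real m - V * t)\<^sup>2)))
      sums (exp (- \<kappa> * (V * t)) * ((1 + \<kappa> * (V * t)) * exp (V * t) - \<kappa> * (V * t * exp (V * t))))"
    by (intro sums_mult sums_diff w_sums var)
  then have lower: "(\<lambda>m. exp (- \<kappa> * (V * t)) * ((1 + \<kappa> * (V * t)) * w m - \<kappa> * (w m * (real m - V * t)\<^sup>2)))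
      sums (exp (- \<kappa> * (V * t)) * exp (V * t))"
    by (simp add: algebra_simps)
  have "exp (- \<kappa> * (V * t)) * exp (V * t) \<le> (\<Sum>m. w m * exp (- \<kappa> * (real m - V * t)\<^sup>2))"
  proof (subst sums_unique[OF lower], rule suminf_le[OF _ sums_summable[OF lower] summ])
    fix m
    define u where "u = \<kappa> * (V * t) - \<kappa> * (real m - V * t)\<^sup>2"
    have "exp (- \<kappa> * (V * t)) * (1 + u) \<le> exp (- \<kappa> * (V * t)) * exp u"
      by (intro mult_left_mono exp_ge_add_one_self) auto
    also have "\<dots> = exp (- \<kappa> * (real m - V * t)\<^sup>2)"
      by (simp add: u_def flip: exp_add)
    finally have "w m * (exp (- \<kappa> * (V * t)) * (1 + u)) \<le> w m * exp (- \<kappa> * (real m - V * t)\<^sup>2)"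
      by (intro mult_left_mono w)
    then show "exp (- \<kappa> * (V * t)) * ((1 + \<kappa> * (V * t)) * w m - \<kappa> * (w m * (real m - V * t)\<^sup>2))
        \<le> w m * exp (- \<kappa> * (real m - V * t)\<^sup>2)"
      by (simp add: u_def algebra_simps)
  qed
  moreover have "\<kappa> * (V * t) = b * t / 2"
    using assms by (simp add: \<kappa>_def)
  ultimately have "exp (- (b * t / 2)) * exp (V * t) \<le> (\<Sum>m. w m * exp (- \<kappa> * (real m - V * t)\<^sup>2))"
    by (simp only: mult_minus_left)
  then have "exp (V * b * t\<^sup>2 / 2) * (exp (- (b * t / 2)) * exp (V * t)) \<le> Z"
    unfolding Z by (rule mult_left_mono) simp
  moreover have "exp (V * (t + b * t\<^sup>2 / 2) - b * t / 2) =
      exp (V * b * t\<^sup>2 / 2) * (exp (- (b * t / 2)) * exp (V * t))"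
  proof -
    have "V * (t + b * t\<^sup>2 / 2) - b * t / 2 = V * b * t\<^sup>2 / 2 + (- (b * t / 2) + V * t)"
      by (simp add: algebra_simps)
    then show ?thesis by (simp only: exp_add)
  qed
  ultimately show "exp (V * (t + b * t\<^sup>2 / 2) - b * t / 2) \<le> Z"
    by (simp only:)
qed

lemma volume_at_top:
  assumes "1 \<le> d"
  shows "filterlim (volume d) at_top sequentially"
proof -
  have "filterlim (\<lambda>N. 2 * real N) at_top sequentially"
    by (intro filterlim_tendsto_pos_mult_at_top[OF tendsto_const] filterlim_real_sequentially) auto
  then show ?thesis
    unfolding volume_def using assms by (intro filterlim_pow_at_top) auto
qed

section \<open>Smoothness through families closed under differentiation\<close>

text \<open>
  Smoothness by coinduction: in a family of functions in which every member has its derivative,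
  again in the family, each iterated derivative agrees on \<open>S\<close> with a member.
\<close>
lemma smooth_onI_closed_family:
  assumes "open S" "f \<in> F"
    and step: "\<And>g. g \<in> F \<Longrightarrow> \<exists>g'\<in>F. \<forall>x\<in>S. DERIV g x :> g' x"
  shows "smooth_on S f"
proof -
  have "\<exists>g\<in>F. \<forall>x\<in>S. (deriv ^^ n) f x = g x" for n
  proof (induction n)
    case 0
    show ?case using \<open>f \<in> F\<close> by auto
  next
    case (Suc n)
    then obtain g where g: "g \<in> F" "\<And>x. x \<in> S \<Longrightarrow> (deriv ^^ n) f x = g x" by blast
    obtain g' where g': "g' \<in> F" "\<And>x. x \<in> S \<Longrightarrow> DERIV g x :> g' x"
      using step[OF g(1)] by blast
    have "(deriv ^^ Suc n) f x = g' x" if "x \<in> S" for x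
    proof -
      have "\<forall>\<^sub>F y in nhds x. (deriv ^^ n) f y = g y"
        using eventually_nhds_in_open[OF \<open>open S\<close> that] by eventually_elim (rule g(2))
      then have "deriv ((deriv ^^ n) f) x = deriv g x"
        by (rule deriv_cong_ev) simp
      then show ?thesis
        using DERIV_imp_deriv[OF g'(2)[OF that]] by simp
    qed
    with g'(1) show ?case by blast
  qed
  moreover have "h differentiable_on S" if h: "g \<in> F" "\<And>x. x \<in> S \<Longrightarrow> h x = g x" for g h
  proof -
    obtain g' where g': "\<And>x. x \<in> S \<Longrightarrow> DERIV g x :> g' x"
      using step[OF h(1)] by blast
    have "DERIV h x :> g' x" if "x \<in> S" for x
      by (rule has_field_derivative_transform_within_open[OF g' \<open>open S\<close>]) (use that h(2) in auto)
    then show ?thesis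
      unfolding differentiable_on_def real_differentiable_def
      by (blast intro: has_field_derivative_at_within)
  qed
  ultimately show ?thesis
    unfolding smooth_on_def by blast
qed

section \<open>Sums in the extended reals and relative entropy\<close>

lemma has_sum_ereal:
  assumes "(f has_sum s) A"
  shows "((\<lambda>k. ereal (f k)) has_sum ereal s) A"
proof -
  have "sum (\<lambda>k. ereal (f k)) = (\<lambda>F. ereal (sum f F))"
    by (rule ext) simp
  then show ?thesis
    using assms by (simp add: has_sum_def)
qed

text \<open>
  Addition on the extended reals is discontinuous at \<open>\<infinity> - \<infinity>\<close>; finiteness of one of the two
  sums excludes this case.
\<close>
lemma has_sum_add_ereal:
  fixes f g :: "'a \<Rightarrow> ereal"
  assumes "(f has_sum s) A" "(g has_sum t) A" "\<bar>s\<bar> \<noteq> \<infinity>"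
  shows "((\<lambda>k. f k + g k) has_sum (s + t)) A"
  using assms unfolding has_sum_def sum.distrib by (intro tendsto_add_ereal_general2)

lemma D_eq_ereal:
  assumes "((\<lambda>k. real k * x k) has_sum s) {1..}"
  shows "D x = ereal s"
  unfolding D_def by (rule infsumI[OF has_sum_ereal[OF assms]])

text \<open>
  The summand of the relative entropy of nonnegative sequences, with the linear terms that make
  it vanish, to second order, at \<open>y = x\<close>.
\<close>
definition entropy_gap :: "real \<Rightarrow> real \<Rightarrow> real" where
  "entropy_gap x y = y * ln (y / x) - y + x"

lemma entropy_gap:
  assumes "0 < x" "0 \<le> y"
  shows entropy_gap_nonneg: "0 \<le> entropy_gap x y"
    and entropy_gap_eq_0_iff: "entropy_gap x y = 0 \<longleftrightarrow> y = x"
proof -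
  have *: "entropy_gap x y = y * (x / y - 1 - ln (x / y))" if "0 < y"
    using that assms(1) by (simp add: entropy_gap_def ln_div algebra_simps)
  have "0 \<le> x / y - 1 - ln (x / y)" if "0 < y"
    using ln_le_minus_one[of "x / y"] that assms(1) by simp
  with * show "0 \<le> entropy_gap x y"
    using assms by (cases "y = 0") (auto simp: entropy_gap_def)
  show "entropy_gap x y = 0 \<longleftrightarrow> y = x"
  proof
    assume 0: "entropy_gap x y = 0"
    then have y: "0 < y"
      using assms by (cases "y = 0") (auto simp: entropy_gap_def)
    with 0 * have "ln (x / y) = x / y - 1" by simp
    then have "x / y = 1"
      using y assms(1) by (intro ln_eq_minus_one) auto
    then show "y = x" using y by simp
  qed (use assms in \<open>simp add: entropy_gap_def\<close>)
qed

section \<open>The pressure and its derivatives\<close>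

context
  fixes d :: nat and \<beta> a :: real
  assumes d: "1 \<le> d" and \<beta>: "0 < \<beta>" and a: "0 < a"
begin

abbreviation (input) W :: "real \<Rightarrow> real" where
  "W \<alpha> \<equiv> W0 (a * \<beta> * qbar d \<beta> \<alpha>)"

lemma W_arg_pos: "\<alpha> \<le> 0 \<Longrightarrow> 0 < a * \<beta> * qbar d \<beta> \<alpha>"
  using qbar_pos[OF d \<beta>] a \<beta> by simp

lemma finite_pressure_tendsto:
  assumes "\<alpha> \<le> 0"
  shows "finite_pressure_CMF d \<beta> a \<alpha> \<longlonglongrightarrow>
    (W \<alpha> + (W \<alpha>)\<^sup>2 / 2) / (a * \<beta>\<^sup>2)"
proof -
  define b where "b = a * \<beta>"
  have b: "0 < b" using a \<beta> by (simp add: b_def)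
  define t where "t = W \<alpha> / b"
  have t: "0 \<le> t"
    using W0_nonneg W_arg_pos[OF assms] b by (auto simp: t_def less_imp_le)
  have qbar_eq: "qbar d \<beta> \<alpha> = t * exp (b * t)"
    using W0_exp[of "a * \<beta> * qbar d \<beta> \<alpha>"] W_arg_pos[OF assms] a \<beta>
    by (simp add: t_def b_def field_simps)
  define \<psi> where "\<psi> = t + b * t\<^sup>2 / 2"
  have bounds: "\<psi> / \<beta> - b * t / (2 * \<beta>) / volume d N \<le> finite_pressure_CMF d \<beta> a \<alpha> N \<and>
      finite_pressure_CMF d \<beta> a \<alpha> N \<le> \<psi> / \<beta>" if N: "1 \<le> N" for N
  proof -
    define V where "V = volume d N"
    have V: "0 < V" using N by (simp add: V_def volume_pos)
    define Z where "Z = (\<Sum>m. (V * (t * exp (b * t))) ^ m / fact m * exp (- (b / (2 * V)) * (real m)\<^sup>2))"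
    have p: "finite_pressure_CMF d \<beta> a \<alpha> N = ln Z / (\<beta> * V)"
      unfolding finite_pressure_CMF_def integral_nu[OF d \<beta> a assms N] Z_def
      by (simp add: V_def b_def qbar_eq)
    note Z_bounds = partition_sum_bounds[OF b V t, folded Z_def \<psi>_def]
    have "0 < Z"
      using Z_bounds(1) exp_gt_zero order_less_le_trans by blast
    then have ln_Z: "V * \<psi> - b * t / 2 \<le> ln Z" "ln Z \<le> V * \<psi>"
      using Z_bounds ln_mono[of "exp (V * \<psi> - b * t / 2)" Z] ln_mono[of Z "exp (V * \<psi>)"] by auto
    have "0 \<le> \<beta> * V"
      using V \<beta> by simp
    note div = ln_Z[THEN divide_right_mono, OF this]
    have eqs: "\<psi> / \<beta> - b * t / (2 * \<beta>) / V = (V * \<psi> - b * t / 2) / (\<beta> * V)"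
        "\<psi> / \<beta> = V * \<psi> / (\<beta> * V)"
      using V \<beta> by (auto simp: field_simps)
    have "\<psi> / \<beta> - b * t / (2 * \<beta>) / V \<le> ln Z / (\<beta> * V)"
      by (subst eqs(1)) (rule div(1))
    moreover have "ln Z / (\<beta> * V) \<le> \<psi> / \<beta>"
      by (subst eqs(2)) (rule div(2))
    ultimately show ?thesis
      by (simp only: p V_def)
  qed
  have "(\<lambda>N. \<psi> / \<beta> - b * t / (2 * \<beta>) / volume d N) \<longlonglongrightarrow> \<psi> / \<beta> - 0"
    by (intro tendsto_diff tendsto_const real_tendsto_divide_at_top[OF tendsto_const] volume_at_top d)
  then have lower: "(\<lambda>N. \<psi> / \<beta> - b * t / (2 * \<beta>) / volume d N) \<longlonglongrightarrow> \<psi> / \<beta>"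
    by simp
  have "finite_pressure_CMF d \<beta> a \<alpha> \<longlonglongrightarrow> \<psi> / \<beta>"
  proof (rule real_tendsto_sandwich[OF _ _ lower tendsto_const])
    show "\<forall>\<^sub>F N in sequentially. \<psi> / \<beta> - b * t / (2 * \<beta>) / volume d N \<le> finite_pressure_CMF d \<beta> a \<alpha> N"
      using eventually_ge_at_top[of 1] by eventually_elim (use bounds in blast)
    show "\<forall>\<^sub>F N in sequentially. finite_pressure_CMF d \<beta> a \<alpha> N \<le> \<psi> / \<beta>"
      using eventually_ge_at_top[of 1] by eventually_elim (use bounds in blast)
  qed
  moreover have "\<psi> / \<beta> = (W \<alpha> + (W \<alpha>)\<^sup>2 / 2) / (a * \<beta>\<^sup>2)"
    using a \<beta> by (simp add: \<psi>_def t_def b_def power2_eq_square field_simps)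
  ultimately show ?thesis by simp
qed

lemma p_CMF_eq:
  assumes "\<alpha> \<le> 0"
  shows "p_CMF d \<beta> a \<alpha> = (W \<alpha> + (W \<alpha>)\<^sup>2 / 2) / (a * \<beta>\<^sup>2)"
  unfolding p_CMF_def by (rule limI[OF finite_pressure_tendsto[OF assms]])

lemma W_pos: "\<alpha> \<le> 0 \<Longrightarrow> 0 < W \<alpha>"
  by (intro W0_pos W_arg_pos)

lemma DERIV_W:
  assumes "\<alpha> < 0"
  shows "DERIV W \<alpha> :> a * \<beta> * moment d \<beta> 1 \<alpha> * exp (- W \<alpha>) / (1 + W \<alpha>)"
proof -
  have "DERIV (\<lambda>\<alpha>. a * \<beta> * qbar d \<beta> \<alpha>) \<alpha> :> a * \<beta> * moment d \<beta> 1 \<alpha>"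
    unfolding qbar_eq_moment using DERIV_moment[OF d \<beta> assms, of 0] by (intro DERIV_cmult) simp
  from DERIV_chain2[OF DERIV_W0[OF W_arg_pos[OF less_imp_le[OF assms]]] this]
  show ?thesis by (simp add: mult_ac)
qed

text \<open>
  The derivative of \<open>W + W\<^sup>2 / 2\<close> is \<open>(1 + W) * W'\<close>, which cancels the denominator in the
  derivative of \<open>W\<close>.
\<close>
lemma DERIV_p_CMF:
  assumes "\<alpha> < 0"
  shows "DERIV (p_CMF d \<beta> a) \<alpha> :> exp (- W \<alpha>) * (moment d \<beta> 1 \<alpha> / \<beta>)"
proof -
  have "DERIV (\<lambda>\<alpha>. (W \<alpha> + (W \<alpha>)\<^sup>2 / 2) / (a * \<beta>\<^sup>2)) \<alpha> :> exp (- W \<alpha>) * (moment d \<beta> 1 \<alpha> / \<beta>)"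
    using W_pos[of \<alpha>] assms a \<beta>
    by (auto intro!: derivative_eq_intros DERIV_W simp: divide_simps power2_eq_square)
      (simp add: algebra_simps)
  moreover have "\<forall>\<^sub>F x in nhds \<alpha>. p_CMF d \<beta> a x = (W x + (W x)\<^sup>2 / 2) / (a * \<beta>\<^sup>2)"
    using eventually_nhds_in_open[of "{..<0}" \<alpha>] assms
    by (auto elim!: eventually_mono intro!: p_CMF_eq)
  ultimately show ?thesis
    by (simp add: DERIV_cong_ev)
qed

text \<open>
  \<open>W\<close> itself is no generator: its derivative, and those of the other generators, are polynomials
  in \<open>exp (- W)\<close>, \<open>1 / (1 + W)\<close> and the moments. The derivative of the pressure is such a
  polynomial as well.
\<close>
inductive_set pressure_algebra :: "(real \<Rightarrow> real) set" where
  const: "(\<lambda>_. c) \<in> pressure_algebra"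
| moment: "moment d \<beta> n \<in> pressure_algebra"
| exp_W: "(\<lambda>\<alpha>. exp (- W \<alpha>)) \<in> pressure_algebra"
| inv_W: "(\<lambda>\<alpha>. 1 / (1 + W \<alpha>)) \<in> pressure_algebra"
| add: "f \<in> pressure_algebra \<Longrightarrow> g \<in> pressure_algebra \<Longrightarrow> (\<lambda>\<alpha>. f \<alpha> + g \<alpha>) \<in> pressure_algebra"
| mult: "f \<in> pressure_algebra \<Longrightarrow> g \<in> pressure_algebra \<Longrightarrow> (\<lambda>\<alpha>. f \<alpha> * g \<alpha>) \<in> pressure_algebra"

lemma pressure_algebra_DERIV:
  assumes "f \<in> pressure_algebra"
  shows "\<exists>f'\<in>pressure_algebra. \<forall>\<alpha>\<in>{..<0}. DERIV f \<alpha> :> f' \<alpha>"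
  using assms
proof induction
  case (const c)
  show ?case
    by (rule bexI[OF _ pressure_algebra.const[of 0]]) simp
next
  case (moment n)
  show ?case
    by (rule bexI[OF _ pressure_algebra.moment[of "Suc n"]]) (simp add: DERIV_moment[OF d \<beta>])
next
  case exp_W
  let ?g = "\<lambda>\<alpha>. - (a * \<beta>) * (moment d \<beta> 1 \<alpha> * ((exp (- W \<alpha>) * exp (- W \<alpha>)) * (1 / (1 + W \<alpha>))))"
  have "?g \<in> pressure_algebra"
    by (intro pressure_algebra.intros)
  moreover have "\<forall>\<alpha>\<in>{..<0}. DERIV (\<lambda>\<alpha>. exp (- W \<alpha>)) \<alpha> :> ?g \<alpha>"
    by (auto intro!: derivative_eq_intros DERIV_W)
  ultimately show ?case by (intro bexI[of _ ?g])
next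
  case inv_W
  let ?g = "\<lambda>\<alpha>. - (a * \<beta>) * (moment d \<beta> 1 \<alpha> * (exp (- W \<alpha>) *
    ((1 / (1 + W \<alpha>)) * ((1 / (1 + W \<alpha>)) * (1 / (1 + W \<alpha>))))))"
  have "?g \<in> pressure_algebra"
    by (intro pressure_algebra.intros)
  moreover have "DERIV (\<lambda>\<alpha>. 1 / (1 + W \<alpha>)) \<alpha> :> ?g \<alpha>" if "\<alpha> < 0" for \<alpha>
    using W_pos[of \<alpha>] that
    by (auto intro!: derivative_eq_intros DERIV_W simp: divide_simps)
  then have "\<forall>\<alpha>\<in>{..<0}. DERIV (\<lambda>\<alpha>. 1 / (1 + W \<alpha>)) \<alpha> :> ?g \<alpha>"
    by blast
  ultimately show ?case by (intro bexI[of _ ?g])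
next
  case (add f g)
  then obtain f' g' where "f' \<in> pressure_algebra" "g' \<in> pressure_algebra"
      "\<forall>\<alpha>\<in>{..<0}. DERIV f \<alpha> :> f' \<alpha>" "\<forall>\<alpha>\<in>{..<0}. DERIV g \<alpha> :> g' \<alpha>"
    by blast
  then show ?case
    by (intro bexI[of _ "\<lambda>\<alpha>. f' \<alpha> + g' \<alpha>"] pressure_algebra.intros) (auto intro: DERIV_add)
next
  case (mult f g)
  then obtain f' g' where "f' \<in> pressure_algebra" "g' \<in> pressure_algebra"
      "\<forall>\<alpha>\<in>{..<0}. DERIV f \<alpha> :> f' \<alpha>" "\<forall>\<alpha>\<in>{..<0}. DERIV g \<alpha> :> g' \<alpha>"
    by blast
  with mult.hyps show ?case
    by (intro bexI[of _ "\<lambda>\<alpha>. f' \<alpha> * g \<alpha> + g' \<alpha> * f \<alpha>"] pressure_algebra.intros) (auto intro: DERIV_mult)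
qed

lemma smooth_on_p_CMF: "smooth_on {..<0} (p_CMF d \<beta> a)"
proof (rule smooth_onI_closed_family[where F = "insert (p_CMF d \<beta> a) pressure_algebra"])
  fix g assume "g \<in> insert (p_CMF d \<beta> a) pressure_algebra"
  then consider "g = p_CMF d \<beta> a" | "g \<in> pressure_algebra" by blast
  then show "\<exists>g'\<in>insert (p_CMF d \<beta> a) pressure_algebra. \<forall>\<alpha>\<in>{..<0}. DERIV g \<alpha> :> g' \<alpha>"
  proof cases
    case 1
    have "(\<lambda>\<alpha>. exp (- W \<alpha>) * (moment d \<beta> 1 \<alpha> * (1 / \<beta>))) \<in> pressure_algebra"
      by (intro pressure_algebra.intros)
    then show ?thesis
      using DERIV_p_CMF 1 by (intro bexI[of _ "\<lambda>\<alpha>. exp (- W \<alpha>) * (moment d \<beta> 1 \<alpha> * (1 / \<beta>))"]) auto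
  next
    case 2
    then show ?thesis
      using pressure_algebra_DERIV by blast
  qed
qed auto

section \<open>The pressure is a closed convex function\<close>

lemma continuous_on_weighted_sum:
  assumes "(\<lambda>k. real k ^ n * q d \<beta> 0 k) summable_on {1..}"
  shows "continuous_on {..0} (\<lambda>\<alpha>. \<Sum>\<^sub>\<infinity>k\<in>{1..}. real k ^ n * q d \<beta> \<alpha> k)"
proof (rule uniform_limit_theorem)
  show "uniform_limit {..0} (\<lambda>F \<alpha>. \<Sum>k\<in>F. real k ^ n * q d \<beta> \<alpha> k)
      (\<lambda>\<alpha>. \<Sum>\<^sub>\<infinity>k\<in>{1..}. real k ^ n * q d \<beta> \<alpha> k) (finite_subsets_at_top {1..})"
    by (rule Weierstrass_m_test_general[OF _ assms])
      (auto simp: abs_mult q_nonneg q_le_q0[OF d \<beta>] intro!: mult_left_mono)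
  have "continuous_on {..0} (\<lambda>\<alpha>. q d \<beta> \<alpha> k)" for k
  proof -
    have "continuous_on {..0} (\<lambda>\<alpha>. exp (\<beta> * real k * \<alpha>) * q d \<beta> 0 k)"
      by (intro continuous_intros)
    also have "(\<lambda>\<alpha>. exp (\<beta> * real k * \<alpha>) * q d \<beta> 0 k) = (\<lambda>\<alpha>. q d \<beta> \<alpha> k)"
      by (rule ext) (rule q_eq[symmetric])
    finally show ?thesis .
  qed
  then show "\<forall>\<^sub>F F in finite_subsets_at_top {1..}.
      continuous_on {..0} (\<lambda>\<alpha>. \<Sum>k\<in>F. real k ^ n * q d \<beta> \<alpha> k)"
    by (intro always_eventually allI continuous_on_sum continuous_on_mult continuous_on_const)
qed simp

lemma continuous_on_qbar: "continuous_on {..0} (qbar d \<beta>)"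
  using continuous_on_weighted_sum[of 0] summable_on_q0[OF d \<beta>] by (simp add: qbar_def[abs_def])

lemma continuous_on_W: "continuous_on {..0} W"
  by (rule continuous_on_compose2[OF continuous_on_W0])
    (auto intro!: continuous_intros continuous_on_qbar dest: W_arg_pos)

lemma continuous_on_p_CMF: "continuous_on {..0} (p_CMF d \<beta> a)"
proof -
  have "continuous_on {..0} (\<lambda>\<alpha>. (W \<alpha> + (W \<alpha>)\<^sup>2 / 2) / (a * \<beta>\<^sup>2))"
    using a \<beta> by (intro continuous_intros continuous_on_W) auto
  then show ?thesis
    by (rule continuous_on_cong[THEN iffD1, OF refl, rotated]) (simp add: p_CMF_eq)
qed

text \<open>
  Hoelder's inequality for the series \<open>qbar\<close>, proved like the classical one: after normalising
  both series to sum \<open>1\<close>, convexity of the exponential is applied termwise.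
\<close>
lemma ln_qbar_convex:
  assumes "x \<le> 0" "y \<le> 0" "0 \<le> u" "0 \<le> v" "u + v = 1"
  shows "ln (qbar d \<beta> (u * x + v * y)) \<le> u * ln (qbar d \<beta> x) + v * ln (qbar d \<beta> y)"
proof -
  define A B where "A = qbar d \<beta> x" and "B = qbar d \<beta> y"
  have AB: "0 < A" "0 < B"
    using qbar_pos[OF d \<beta>] assms by (auto simp: A_def B_def)
  have z: "u * x + v * y \<le> 0"
    using assms by (simp add: add_nonpos_nonpos mult_nonneg_nonpos)
  define C where "C = exp (u * ln A + v * ln B)"
  have term_le: "q d \<beta> (u * x + v * y) k \<le> C * (u / A * q d \<beta> x k + v / B * q d \<beta> y k)" for k
  proof -
    define s t where "s = \<beta> * real k * x - ln A" and "t = \<beta> * real k * y - ln B"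
    have u: "u = 1 - v" and v: "0 \<le> v" "v \<le> 1"
      using assms by auto
    have "exp (u * s + v * t) \<le> u * exp s + v * exp t"
      using convex_onD[OF exp_convex v, of s t] by (simp add: u)
    then have "C * exp (u * s + v * t) \<le> C * (u * exp s + v * exp t)"
      by (intro mult_left_mono) (auto simp: C_def)
    moreover have "C * exp (u * s + v * t) = exp (\<beta> * real k * (u * x + v * y))"
      by (simp add: C_def s_def t_def algebra_simps flip: exp_add)
    moreover have "exp s = exp (\<beta> * real k * x) / A" "exp t = exp (\<beta> * real k * y) / B"
      using AB by (simp_all add: s_def t_def exp_diff)
    ultimately have "exp (\<beta> * real k * (u * x + v * y)) \<le>
        C * (u / A * exp (\<beta> * real k * x) + v / B * exp (\<beta> * real k * y))"
      by (simp add: field_simps)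
    from mult_right_mono[OF this q_nonneg[of d \<beta> 0 k]] show ?thesis
      by (subst (1 2 3) q_eq) (simp add: algebra_simps)
  qed
  have "qbar d \<beta> (u * x + v * y) \<le> C * (u / A * A + v / B * B)"
    by (rule has_sum_mono[OF has_sum_qbar[OF d \<beta> z] _ term_le], unfold A_def B_def,
      intro has_sum_cmult_right has_sum_add has_sum_qbar[OF d \<beta>] assms)
  also have "\<dots> = C"
    using AB assms by simp
  finally have "ln (qbar d \<beta> (u * x + v * y)) \<le> ln C"
    using qbar_pos[OF d \<beta> z] by (intro ln_mono) (auto simp: C_def)
  then show ?thesis
    by (simp add: C_def A_def B_def)
qed

text \<open>
  The pressure as a maximum over \<open>w > 0\<close>, attained at \<open>w = W\<close>. In terms of the loop density
  \<open>w / (a * \<beta>)\<close> this is, up to a factor \<open>1 / \<beta>\<close>, the exponential growth rate of the summands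
  of the partition function. For fixed \<open>w\<close> the expression is affine and increasing in
  \<open>ln qbar\<close>.
\<close>
lemma p_CMF_variational:
  assumes "\<alpha> \<le> 0" "0 < w"
  shows "(w * ln (a * \<beta> * qbar d \<beta> \<alpha>) - w * ln w + w - w\<^sup>2 / 2) / (a * \<beta>\<^sup>2) \<le> p_CMF d \<beta> a \<alpha>"
    and "w = W \<alpha> \<Longrightarrow>
      p_CMF d \<beta> a \<alpha> = (w * ln (a * \<beta> * qbar d \<beta> \<alpha>) - w * ln w + w - w\<^sup>2 / 2) / (a * \<beta>\<^sup>2)"
proof -
  have Wp: "0 < W \<alpha>" and ab: "0 < a * \<beta> * qbar d \<beta> \<alpha>"
    using W_pos[OF assms(1)] W_arg_pos[OF assms(1)] .
  have ln_eq: "ln (a * \<beta> * qbar d \<beta> \<alpha>) = ln (W \<alpha>) + W \<alpha>"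
    using W0_exp[OF less_imp_le[OF ab]] Wp by (metis ln_exp ln_mult_pos exp_gt_zero)
  have "w * ln (W \<alpha> / w) \<le> w * (W \<alpha> / w - 1)"
    using Wp assms(2) by (intro mult_left_mono ln_le_minus_one) auto
  then have "w * ln (W \<alpha>) - w * ln w + w \<le> W \<alpha>"
    using Wp assms(2) by (simp add: ln_div algebra_simps)
  moreover have "0 \<le> (w - W \<alpha>)\<^sup>2" by simp
  ultimately have "w * ln (a * \<beta> * qbar d \<beta> \<alpha>) - w * ln w + w - w\<^sup>2 / 2 \<le> W \<alpha> + (W \<alpha>)\<^sup>2 / 2"
    unfolding ln_eq power2_eq_square by (simp add: algebra_simps)
  then show "(w * ln (a * \<beta> * qbar d \<beta> \<alpha>) - w * ln w + w - w\<^sup>2 / 2) / (a * \<beta>\<^sup>2) \<le> p_CMF d \<beta> a \<alpha>"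
    unfolding p_CMF_eq[OF assms(1)] using a by (intro divide_right_mono) auto
  show "p_CMF d \<beta> a \<alpha> = (w * ln (a * \<beta> * qbar d \<beta> \<alpha>) - w * ln w + w - w\<^sup>2 / 2) / (a * \<beta>\<^sup>2)"
    if "w = W \<alpha>"
    unfolding p_CMF_eq[OF assms(1)] that ln_eq
    by (intro arg_cong2[where f = "(/)"]) (simp_all add: algebra_simps power2_eq_square)
qed

text \<open>The maximiser at the intermediate point serves as a common trial point at both ends.\<close>
lemma convex_on_p_CMF:
  assumes "x \<le> 0" "y \<le> 0" "0 \<le> u" "0 \<le> v" "u + v = 1"
  shows "p_CMF d \<beta> a (u * x + v * y) \<le> u * p_CMF d \<beta> a x + v * p_CMF d \<beta> a y"
proof -
  define z where "z = u * x + v * y"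
  have z: "z \<le> 0"
    using assms by (simp add: z_def add_nonpos_nonpos mult_nonneg_nonpos)
  define w where "w = W z"
  have w: "0 < w"
    using W_pos[OF z] by (simp add: w_def)
  define \<phi> where "\<phi> \<alpha> = (w * ln (a * \<beta> * qbar d \<beta> \<alpha>) - w * ln w + w - w\<^sup>2 / 2) / (a * \<beta>\<^sup>2)" for \<alpha>
  have \<phi>: "\<phi> \<alpha> = w / (a * \<beta>\<^sup>2) * ln (qbar d \<beta> \<alpha>) + (w * ln (a * \<beta>) - w * ln w + w - w\<^sup>2 / 2) / (a * \<beta>\<^sup>2)"
    if "\<alpha> \<le> 0" for \<alpha>
    using qbar_pos[OF d \<beta> that] a \<beta> by (simp add: \<phi>_def ln_mult_pos add_divide_distrib diff_divide_distrib algebra_simps)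
  have "p_CMF d \<beta> a z = \<phi> z"
    using p_CMF_variational(2)[OF z w] by (simp add: \<phi>_def w_def)
  also have "\<dots> \<le> u * \<phi> x + v * \<phi> y"
  proof -
    define m c where "m = w / (a * \<beta>\<^sup>2)" and "c = (w * ln (a * \<beta>) - w * ln w + w - w\<^sup>2 / 2) / (a * \<beta>\<^sup>2)"
    have "m * ln (qbar d \<beta> z) \<le> m * (u * ln (qbar d \<beta> x) + v * ln (qbar d \<beta> y))"
      using ln_qbar_convex[OF assms] w a by (intro mult_left_mono) (auto simp: m_def z_def)
    moreover have "u * c + v * c = c"
      using assms(5) by (simp flip: distrib_right)
    ultimately show ?thesis
      unfolding \<phi>[OF z] \<phi>[OF assms(1)] \<phi>[OF assms(2)] m_def[symmetric] c_def[symmetric]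
      by (simp add: algebra_simps)
  qed
  also have "\<dots> \<le> u * p_CMF d \<beta> a x + v * p_CMF d \<beta> a y"
    using assms p_CMF_variational(1)[OF _ w] by (intro add_mono mult_left_mono) (auto simp: \<phi>_def)
  finally show ?thesis by (simp add: z_def)
qed

lemma closed_convex_p_CMF_ext: "closed_convex_function (p_CMF_ext d \<beta> a)"
proof -
  have epi: "epigraph_ereal (p_CMF_ext d \<beta> a) = {z. fst z \<le> 0 \<and> p_CMF d \<beta> a (fst z) \<le> snd z}"
    by (auto simp: epigraph_ereal_def p_CMF_ext_def split: if_splits)
  have "convex {z. fst z \<le> 0 \<and> p_CMF d \<beta> a (fst z) \<le> snd z}"
  proof (rule convexI, safe)
    fix x s y t u v :: real
    assume *: "fst (x, s) \<le> 0" "p_CMF d \<beta> a (fst (x, s)) \<le> snd (x, s)"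
      "fst (y, t) \<le> 0" "p_CMF d \<beta> a (fst (y, t)) \<le> snd (y, t)" "0 \<le> u" "0 \<le> v" "u + v = 1"
    then show "fst (u *\<^sub>R (x, s) + v *\<^sub>R (y, t)) \<le> 0"
      by (simp add: add_nonpos_nonpos mult_nonneg_nonpos)
    have "p_CMF d \<beta> a (u * x + v * y) \<le> u * p_CMF d \<beta> a x + v * p_CMF d \<beta> a y"
      using * by (intro convex_on_p_CMF) auto
    also have "\<dots> \<le> u * s + v * t"
      using * by (intro add_mono mult_left_mono) auto
    finally show "p_CMF d \<beta> a (fst (u *\<^sub>R (x, s) + v *\<^sub>R (y, t))) \<le> snd (u *\<^sub>R (x, s) + v *\<^sub>R (y, t))"
      by simp
  qed
  moreover have "closed {z. fst z \<le> 0 \<and> p_CMF d \<beta> a (fst z) \<le> snd z}"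
  proof -
    have "continuous_on ({..0} \<times> UNIV) (\<lambda>z. p_CMF d \<beta> a (fst z) - snd z)"
      by (intro continuous_on_diff continuous_on_compose2[OF continuous_on_p_CMF]
          continuous_on_fst continuous_on_snd continuous_on_id) auto
    then have "closed (({..0} \<times> UNIV) \<inter> (\<lambda>z. p_CMF d \<beta> a (fst z) - snd z) -` {..0})"
      by (rule continuous_closed_preimage) (auto intro: closed_Times)
    moreover have "({..0} \<times> UNIV) \<inter> (\<lambda>z. p_CMF d \<beta> a (fst z) - snd z) -` {..0} =
        {z. fst z \<le> 0 \<and> p_CMF d \<beta> a (fst z) \<le> snd z}"
      by auto
    ultimately show ?thesis by simp
  qed
  ultimately show ?thesis
    by (simp add: closed_convex_function_def epi)
qed

section \<open>The minimiser of the rate functional\<close>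

text \<open>The minimiser; the restriction makes it extensional, like all members of \<open>l1_nonneg\<close>.\<close>
definition tilted_q :: "real \<Rightarrow> nat \<Rightarrow> real" where
  "tilted_q \<alpha> = (\<lambda>k\<in>{1..}. exp (- W \<alpha>) * q d \<beta> \<alpha> k)"

context
  fixes \<alpha> :: real
  assumes \<alpha>: "\<alpha> \<le> 0"
begin

lemma tilted_q_pos: "1 \<le> k \<Longrightarrow> 0 < tilted_q \<alpha> k"
  by (simp add: tilted_q_def q_pos[OF \<beta>])

lemma has_sum_tilted_q:
  "(tilted_q \<alpha> has_sum (W \<alpha> / (a * \<beta>))) {1..}"
proof -
  have "((\<lambda>k. exp (- W \<alpha>) * q d \<beta> \<alpha> k) has_sum
      (exp (- W \<alpha>) * qbar d \<beta> \<alpha>)) {1..}"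
    by (intro has_sum_cmult_right has_sum_qbar d \<beta> \<alpha>)
  also have "exp (- W \<alpha>) * qbar d \<beta> \<alpha> = W \<alpha> / (a * \<beta>)"
    using W0_div_self[OF W_arg_pos[OF \<alpha>], symmetric] qbar_pos[OF d \<beta> \<alpha>] a \<beta> by simp
  finally show ?thesis
    by (rule has_sum_cong[THEN iffD1, rotated]) (simp add: tilted_q_def)
qed

lemma tilted_q_in_l1: "tilted_q \<alpha> \<in> l1_nonneg"
  using has_sum_tilted_q q_nonneg
  by (auto simp: l1_nonneg_def has_sum_iff tilted_q_def simp del: One_nat_def)

text \<open>
  Replacing \<open>q\<close> by \<open>exp (- W) * q\<close> as reference sequence changes the entropy by a
  term linear in the total mass, and the tilt is chosen such that this term completes the square of
  the mean-field energy.
\<close>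
lemma rate_plus_H_eq:
  assumes y: "y \<in> l1_nonneg"
  defines "t \<equiv> W \<alpha> / (a * \<beta>)"
  shows "rate_I d \<beta> \<alpha> y + ereal (H_CMF a y) =
    (\<Sum>\<^sub>\<infinity>k\<in>{1..}. ereal (entropy_gap (tilted_q \<alpha> k) (y k) / \<beta>)) +
    ereal (qbar d \<beta> \<alpha> / \<beta> - t / \<beta> - a / 2 * t\<^sup>2 + a / 2 * ((\<Sum>\<^sub>\<infinity>k\<in>{1..}. y k) - t)\<^sup>2)"
proof -
  define w where "w = W \<alpha>"
  have w: "w = a * \<beta> * t"
    using a \<beta> by (simp add: w_def t_def)
  define Y where "Y = infsum y {1..}"
  define S where "S = (\<Sum>\<^sub>\<infinity>k\<in>{1..}. ereal (entropy_gap (tilted_q \<alpha> k) (y k) / \<beta>))"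
  have y_nonneg: "0 \<le> y k" if "1 \<le> k" for k
    using y that by (auto simp: l1_nonneg_def PiE_iff)
  have y_sum: "(y has_sum Y) {1..}"
    using y by (simp add: l1_nonneg_def Y_def)
  have gap: "((\<lambda>k. ereal (entropy_gap (tilted_q \<alpha> k) (y k) / \<beta>)) has_sum S) {1..}"
    unfolding S_def using \<beta>
    by (intro has_sum_infsum nonneg_summable_on_complete)
      (auto intro!: divide_nonneg_pos entropy_gap_nonneg tilted_q_pos y_nonneg)
  have "((\<lambda>k. (- 1 / \<beta>) * tilted_q \<alpha> k + (- w / \<beta>) * y k) has_sum ((- 1 / \<beta>) * t + (- w / \<beta>) * Y)) {1..}"
    unfolding t_def by (intro has_sum_add has_sum_cmult_right has_sum_tilted_q y_sum)
  from has_sum_add_ereal[OF has_sum_ereal[OF this] gap]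
  have sum: "((\<lambda>k. ereal ((- 1 / \<beta>) * tilted_q \<alpha> k + (- w / \<beta>) * y k) +
      ereal (entropy_gap (tilted_q \<alpha> k) (y k) / \<beta>)) has_sum
    (ereal ((- 1 / \<beta>) * t + (- w / \<beta>) * Y) + S)) {1..}"
    by simp
  have summand: "ereal ((- 1 / \<beta>) * tilted_q \<alpha> k + (- w / \<beta>) * y k) +
      ereal (entropy_gap (tilted_q \<alpha> k) (y k) / \<beta>) = ereal (y k / \<beta> * (ln (y k / q d \<beta> \<alpha> k) - 1))"
    if k: "k \<in> {1..}" for k
  proof (cases "y k = 0")
    case False
    then have "0 < y k"
      using y_nonneg[of k] k by auto
    moreover have "0 < q d \<beta> \<alpha> k"
      using q_pos[OF \<beta>] k by simp
    moreover have "tilted_q \<alpha> k = exp (- w) * q d \<beta> \<alpha> k"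
      using k by (simp add: tilted_q_def w_def)
    ultimately have "ln (y k / tilted_q \<alpha> k) = ln (y k / q d \<beta> \<alpha> k) + w"
      by (simp add: ln_div ln_mult_pos)
    then have "entropy_gap (tilted_q \<alpha> k) (y k) = y k * (ln (y k / q d \<beta> \<alpha> k) + w) - y k + tilted_q \<alpha> k"
      by (simp add: entropy_gap_def)
    then show ?thesis
      using \<beta> by (simp add: field_simps)
  qed (simp add: entropy_gap_def)
  have "(\<Sum>\<^sub>\<infinity>k\<in>{1..}. ereal (y k / \<beta> * (ln (y k / q d \<beta> \<alpha> k) - 1))) =
      ereal ((- 1 / \<beta>) * t + (- w / \<beta>) * Y) + S"
    using has_sum_cong[THEN iffD1, OF summand sum] by (rule infsumI)
  then have "rate_I d \<beta> \<alpha> y + ereal (H_CMF a y) =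
      S + ereal (((- 1 / \<beta>) * t + (- w / \<beta>) * Y) + (qbar d \<beta> \<alpha> / \<beta> + a / 2 * Y\<^sup>2))"
    unfolding rate_I_def H_CMF_def Y_def[symmetric]
    by (cases S) (simp_all add: algebra_simps)
  also have "((- 1 / \<beta>) * t + (- w / \<beta>) * Y) + (qbar d \<beta> \<alpha> / \<beta> + a / 2 * Y\<^sup>2) =
      qbar d \<beta> \<alpha> / \<beta> - t / \<beta> - a / 2 * t\<^sup>2 + a / 2 * (Y - t)\<^sup>2"
    unfolding w power2_eq_square using \<beta> by (simp add: field_simps)
  finally show ?thesis
    unfolding S_def Y_def .
qed

lemma is_minimiser_CMF_iff: "is_minimiser_CMF d \<beta> a \<alpha> y \<longleftrightarrow> y = tilted_q \<alpha>"
proof -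
  define t where "t = W \<alpha> / (a * \<beta>)"
  define m where "m = qbar d \<beta> \<alpha> / \<beta> - t / \<beta> - a / 2 * t\<^sup>2"
  define S where "S y = (\<Sum>\<^sub>\<infinity>k\<in>{1..}. ereal (entropy_gap (tilted_q \<alpha> k) (y k) / \<beta>))" for y
  define F where "F y = rate_I d \<beta> \<alpha> y + ereal (H_CMF a y)" for y
  have F: "F y = S y + ereal (m + a / 2 * (infsum y {1..} - t)\<^sup>2)" if "y \<in> l1_nonneg" for y
    using rate_plus_H_eq[OF that] by (simp only: F_def S_def m_def t_def)
  have gap: "0 \<le> ereal (entropy_gap (tilted_q \<alpha> k) (y k) / \<beta>)" if "y \<in> l1_nonneg" "k \<in> {1..}" for y k
  proof -
    have "0 \<le> y k"
      using that by (auto simp: l1_nonneg_def PiE_iff)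
    then show ?thesis
      using \<beta> entropy_gap_nonneg[OF tilted_q_pos] that(2) by simp
  qed
  have S_nonneg: "0 \<le> S y" if "y \<in> l1_nonneg" for y
    unfolding S_def using gap[OF that] by (rule infsum_nonneg)
  have F_min: "F (tilted_q \<alpha>) = ereal m"
  proof -
    have "S (tilted_q \<alpha>) = (\<Sum>\<^sub>\<infinity>k\<in>{1::nat..}. 0)"
      unfolding S_def by (rule infsum_cong) (simp add: entropy_gap_eq_0_iff tilted_q_pos less_imp_le)
    then show ?thesis
      using F[OF tilted_q_in_l1] infsumI[OF has_sum_tilted_q] by (simp add: t_def)
  qed
  have F_ge: "ereal m \<le> F y" if "y \<in> l1_nonneg" for y
  proof -
    have "0 + ereal m \<le> S y + ereal (m + a / 2 * (infsum y {1..} - t)\<^sup>2)"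
      using a by (intro add_mono S_nonneg that) simp
    then show ?thesis by (simp add: F[OF that])
  qed
  have F_eq: "y = tilted_q \<alpha>" if y: "y \<in> l1_nonneg" and le: "F y \<le> ereal m" for y
  proof -
    have "S y + ereal m \<le> S y + ereal (m + a / 2 * (infsum y {1..} - t)\<^sup>2)"
      using a by (intro add_left_mono) simp
    also have "\<dots> \<le> ereal m"
      using le by (simp add: F[OF y])
    finally have S0: "S y \<le> 0"
      by (cases "S y") auto
    have "y k = tilted_q \<alpha> k" if k: "k \<in> {1..}" for k
    proof -
      have "infsum (\<lambda>k. ereal (entropy_gap (tilted_q \<alpha> k) (y k) / \<beta>)) {k} \<le> S y"
        unfolding S_def using gap[OF y] k
        by (intro infsum_mono_neutral nonneg_summable_on_complete) auto
      then have "entropy_gap (tilted_q \<alpha> k) (y k) / \<beta> \<le> 0"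
        using S0 by (simp add: zero_ereal_def) (meson ereal_less_eq(3) order_trans)
      then have "entropy_gap (tilted_q \<alpha> k) (y k) = 0"
        using gap[OF y k] \<beta> by (simp add: divide_le_0_iff zero_le_divide_iff)
      moreover have "0 \<le> y k"
        using y k by (auto simp: l1_nonneg_def PiE_iff)
      ultimately show ?thesis
        using entropy_gap_eq_0_iff[OF tilted_q_pos] k by auto
    qed
    moreover have "y \<in> extensional {1..}" "tilted_q \<alpha> \<in> extensional {1..}"
      using y tilted_q_in_l1 by (auto simp: l1_nonneg_def PiE_def)
    ultimately show ?thesis
      by (intro extensionalityI) auto
  qed
  show ?thesis
    unfolding is_minimiser_CMF_def is_arg_min_def F_def[symmetric]
    using F_min F_ge F_eq tilted_q_in_l1 by (metis linorder_not_le)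
qed

lemma xi_CMF_eq: "xi_CMF d \<beta> a \<alpha> = tilted_q \<alpha>"
  by (simp add: xi_CMF_def is_minimiser_CMF_iff)

end

section \<open>Particle densities\<close>

lemma eventually_at_left_0: "\<forall>\<^sub>F \<alpha> in at_left (0::real). \<alpha> < 0"
  by (simp add: eventually_at_filter)

text \<open>
  The particle density of the ideal Bose gas. Unlike \<open>D (q d \<beta> \<alpha>)\<close> it is real, with the
  default value \<open>0\<close> where the series diverges.
\<close>
definition ideal_density :: "real \<Rightarrow> real" where
  "ideal_density \<alpha> = (\<Sum>\<^sub>\<infinity>k\<in>{1..}. real k * q d \<beta> \<alpha> k)"

lemma has_sum_ideal_density:
  assumes "\<alpha> < 0"
  shows "((\<lambda>k. real k * q d \<beta> \<alpha> k) has_sum ideal_density \<alpha>) {1..}"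
    and "ideal_density \<alpha> = moment d \<beta> 1 \<alpha> / \<beta>"
proof -
  have "((\<lambda>k. (\<beta> * real k) ^ 1 * q d \<beta> \<alpha> k) has_sum moment d \<beta> 1 \<alpha>) {1..}"
    unfolding moment_def by (rule has_sum_infsum[OF summable_on_moment[OF d \<beta> assms]])
  from has_sum_cmult_right[OF this, of "1 / \<beta>"]
  have *: "((\<lambda>k. real k * q d \<beta> \<alpha> k) has_sum (moment d \<beta> 1 \<alpha> / \<beta>)) {1..}"
    using \<beta> by simp
  then show "ideal_density \<alpha> = moment d \<beta> 1 \<alpha> / \<beta>"
    unfolding ideal_density_def by (rule infsumI)
  with * show "((\<lambda>k. real k * q d \<beta> \<alpha> k) has_sum ideal_density \<alpha>) {1..}"
    by simp
qed

lemma D_q: "\<alpha> < 0 \<Longrightarrow> D (q d \<beta> \<alpha>) = ereal (ideal_density \<alpha>)"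
  by (rule D_eq_ereal[OF has_sum_ideal_density(1)])

lemma D_xi_CMF:
  assumes "\<alpha> < 0"
  shows "D (xi_CMF d \<beta> a \<alpha>) = ereal (exp (- W \<alpha>) * ideal_density \<alpha>)"
proof (rule D_eq_ereal)
  have "((\<lambda>k. exp (- W \<alpha>) * (real k * q d \<beta> \<alpha> k)) has_sum
      (exp (- W \<alpha>) * ideal_density \<alpha>)) {1..}"
    by (intro has_sum_cmult_right has_sum_ideal_density assms)
  then show "((\<lambda>k. real k * xi_CMF d \<beta> a \<alpha> k) has_sum
      (exp (- W \<alpha>) * ideal_density \<alpha>)) {1..}"
    by (rule has_sum_cong[THEN iffD1, rotated])
      (use assms in \<open>simp add: xi_CMF_eq tilted_q_def\<close>)
qed

lemma k_q0_eq:
  "real k * q d \<beta> 0 k = (4 * pi * \<beta>) powr (- real d / 2) * (1 / real k powr (real d / 2))"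
proof (cases "k = 0")
  case False
  then have "real k powr (1 + real d / 2) = real k * real k powr (real d / 2)"
    by (simp add: powr_add)
  moreover have "(4 * pi * \<beta>) powr (- real d / 2) = inverse ((4 * pi * \<beta>) powr (real d / 2))"
    by (simp flip: powr_minus)
  ultimately show ?thesis
    using False by (simp add: q_def divide_simps)
qed simp

lemma summable_on_k_q0_iff: "(\<lambda>k. real k * q d \<beta> 0 k) summable_on {1..} \<longleftrightarrow> 3 \<le> d"
proof -
  have "(\<lambda>k. real k * q d \<beta> 0 k) summable_on {1..} \<longleftrightarrow> (\<lambda>k. real k * q d \<beta> 0 k) summable_on UNIV"
    by (rule summable_on_cong_neutral) (auto simp: not_le)
  also have "\<dots> \<longleftrightarrow> summable (\<lambda>k. real k * q d \<beta> 0 k)"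
    by (simp add: summable_on_UNIV_nonneg_real_iff q_nonneg)
  also have "\<dots> \<longleftrightarrow> summable (\<lambda>k. (4 * pi * \<beta>) powr (- real d / 2) * real k powr (- (real d / 2)))"
    unfolding k_q0_eq by (simp only: powr_minus_divide)
  also have "\<dots> \<longleftrightarrow> summable (\<lambda>k. real k powr (- (real d / 2)))"
    using \<beta> by (subst summable_cmult_iff) auto
  also have "\<dots> \<longleftrightarrow> 3 \<le> d"
    by (subst summable_real_powr_iff) linarith
  finally show ?thesis .
qed

lemma ideal_density_0: "ideal_density 0 = rho_c d \<beta>"
  unfolding ideal_density_def rho_c_def k_q0_eq by (rule infsum_cmult_right')

text \<open>
  A finite partial sum of the divergent series at \<open>\<alpha> = 0\<close> exceeds any bound, and it is continuous
  in \<open>\<alpha>\<close>.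
\<close>
lemma ideal_density_at_top:
  assumes "d \<le> 2"
  shows "filterlim ideal_density at_top (at_left 0)"
  unfolding filterlim_at_top_dense
proof
  fix Z
  have "\<exists>F. finite F \<and> F \<subseteq> {1..} \<and> Z < (\<Sum>k\<in>F. real k * q d \<beta> 0 k)"
  proof (rule ccontr)
    assume "\<not> ?thesis"
    then have "(\<lambda>k. real k * q d \<beta> 0 k) summable_on {1..}"
      by (intro nonneg_bdd_above_summable_on bdd_aboveI2[where M = Z]) (auto simp: q_nonneg not_less)
    with assms show False
      unfolding summable_on_k_q0_iff by simp
  qed
  then obtain F where F: "finite F" "F \<subseteq> {1..}" "Z < (\<Sum>k\<in>F. real k * q d \<beta> 0 k)"
    by blast
  have "((\<lambda>\<alpha>. \<Sum>k\<in>F. real k * (exp (\<beta> * real k * \<alpha>) * q d \<beta> 0 k)) \<longlongrightarrow>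
      (\<Sum>k\<in>F. real k * (exp (\<beta> * real k * 0) * q d \<beta> 0 k))) (at_left 0)"
    by (intro tendsto_intros)
  then have "((\<lambda>\<alpha>. \<Sum>k\<in>F. real k * q d \<beta> \<alpha> k) \<longlongrightarrow> (\<Sum>k\<in>F. real k * q d \<beta> 0 k)) (at_left 0)"
    by (simp flip: q_eq)
  from order_tendstoD(1)[OF this F(3)] eventually_at_left_0
  show "\<forall>\<^sub>F \<alpha> in at_left 0. Z < ideal_density \<alpha>"
  proof eventually_elim
    case (elim \<alpha>)
    have "(\<Sum>k\<in>F. real k * q d \<beta> \<alpha> k) \<le> ideal_density \<alpha>"
      unfolding ideal_density_def using F(1,2) has_sum_ideal_density(1)[OF elim(2)]
      by (intro finite_sum_le_infsum) (auto simp: has_sum_iff q_nonneg)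
    with elim(1) show ?case by linarith
  qed
qed

section \<open>The critical density\<close>

lemma deriv_p_CMF:
  assumes "\<alpha> < 0"
  shows "deriv (p_CMF d \<beta> a) \<alpha> = exp (- W \<alpha>) * ideal_density \<alpha>"
  using DERIV_imp_deriv[OF DERIV_p_CMF[OF assms]] has_sum_ideal_density(2)[OF assms] by simp

lemma exp_W_tendsto: "((\<lambda>\<alpha>. exp (- W \<alpha>)) \<longlongrightarrow> exp (- W 0)) (at_left 0)"
proof -
  have "(W \<longlongrightarrow> W 0) (at 0 within {..0})"
    using continuous_on_W by (simp add: continuous_on_def)
  then have "(W \<longlongrightarrow> W 0) (at_left 0)"
    by (rule tendsto_within_subset) auto
  then show ?thesis by (intro tendsto_intros)
qed

lemma deriv_p_CMF_tendsto:
  "((\<lambda>\<alpha>. ereal (deriv (p_CMF d \<beta> a) \<alpha>)) \<longlongrightarrow>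
    (if d \<le> 2 then \<infinity> else ereal (exp (- W 0) * rho_c d \<beta>))) (at_left 0)"
proof -
  have "((\<lambda>\<alpha>. ereal (exp (- W \<alpha>) * ideal_density \<alpha>)) \<longlongrightarrow>
    (if d \<le> 2 then \<infinity> else ereal (exp (- W 0) * rho_c d \<beta>))) (at_left 0)"
  proof (cases "d \<le> 2")
    case True
    have "filterlim (\<lambda>\<alpha>. exp (- W \<alpha>) * ideal_density \<alpha>) at_top (at_left 0)"
      by (rule filterlim_tendsto_pos_mult_at_top[OF exp_W_tendsto _ ideal_density_at_top[OF True]]) simp
    with True show ?thesis
      by (simp add: tendsto_PInfty_eq_at_top)
  next
    case False
    then have "continuous_on {..0} (\<lambda>\<alpha>. \<Sum>\<^sub>\<infinity>k\<in>{1..}. real k ^ 1 * q d \<beta> \<alpha> k)"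
      using summable_on_k_q0_iff by (intro continuous_on_weighted_sum) simp
    then have "continuous_on {..0} ideal_density"
      by (simp add: ideal_density_def[abs_def])
    then have "(ideal_density \<longlongrightarrow> ideal_density 0) (at 0 within {..0})"
      by (simp add: continuous_on_def)
    then have "(ideal_density \<longlongrightarrow> rho_c d \<beta>) (at_left 0)"
      unfolding ideal_density_0 by (rule tendsto_within_subset) auto
    from tendsto_mult[OF exp_W_tendsto this] False show ?thesis
      by simp
  qed
  moreover have "\<forall>\<^sub>F \<alpha> in at_left 0. ereal (deriv (p_CMF d \<beta> a) \<alpha>) =
      ereal (exp (- W \<alpha>) * ideal_density \<alpha>)"
    using eventually_at_left_0 by eventually_elim (simp add: deriv_p_CMF)
  ultimately show ?thesis
    using tendsto_cong by fast
qed

end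

theorem proposition3p3:
  fixes d :: nat and \<beta> a :: real
  assumes "d \<ge> 1" and "\<beta> > 0" and "a > 0"
  shows
    "(\<forall>\<alpha>\<le>0. convergent (\<lambda>N. finite_pressure_CMF d \<beta> a \<alpha> N)) \<and>
     (\<forall>\<alpha><0. \<exists>!x. is_minimiser_CMF d \<beta> a \<alpha> x) \<and>
     closed_convex_function (p_CMF_ext d \<beta> a) \<and>
     smooth_on {..<0} (p_CMF d \<beta> a) \<and>
     (\<forall>\<alpha><0. ereal (deriv (p_CMF d \<beta> a) \<alpha>) = D (xi_CMF d \<beta> a \<alpha>) \<and>
        D (xi_CMF d \<beta> a \<alpha>) =
          ereal (W0 (a * \<beta> * qbar d \<beta> \<alpha>) / (a * \<beta> * qbar d \<beta> \<alpha>)) * D (q d \<beta> \<alpha>)) \<and>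
     ((\<lambda>\<alpha>. ereal (deriv (p_CMF d \<beta> a) \<alpha>)) \<longlongrightarrow>
        (if d \<le> 2 then \<infinity>
         else ereal (W0 (a * \<beta> * qbar d \<beta> 0) / (a * \<beta> * qbar d \<beta> 0) * rho_c d \<beta>)))
       (at_left 0)"
proof -
  have ratio: "W0 (a * \<beta> * qbar d \<beta> \<alpha>) / (a * \<beta> * qbar d \<beta> \<alpha>) = exp (- W0 (a * \<beta> * qbar d \<beta> \<alpha>))"
    if "\<alpha> \<le> 0" for \<alpha>
    by (rule W0_div_self[OF W_arg_pos[OF assms that]])
  show ?thesis
  proof (intro conjI allI impI)
    show "convergent (\<lambda>N. finite_pressure_CMF d \<beta> a \<alpha> N)" if "\<alpha> \<le> 0" for \<alpha>
      using finite_pressure_tendsto[OF assms that] by (rule convergentI)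
    show "\<exists>!x. is_minimiser_CMF d \<beta> a \<alpha> x" if "\<alpha> < 0" for \<alpha>
      using is_minimiser_CMF_iff[OF assms] that by simp
    show "closed_convex_function (p_CMF_ext d \<beta> a)"
      by (rule closed_convex_p_CMF_ext[OF assms])
    show "smooth_on {..<0} (p_CMF d \<beta> a)"
      by (rule smooth_on_p_CMF[OF assms])
    show "ereal (deriv (p_CMF d \<beta> a) \<alpha>) = D (xi_CMF d \<beta> a \<alpha>)" if "\<alpha> < 0" for \<alpha>
      by (simp only: deriv_p_CMF[OF assms that] D_xi_CMF[OF assms that])
    show "D (xi_CMF d \<beta> a \<alpha>) =
        ereal (W0 (a * \<beta> * qbar d \<beta> \<alpha>) / (a * \<beta> * qbar d \<beta> \<alpha>)) * D (q d \<beta> \<alpha>)" if "\<alpha> < 0" for \<alpha>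
      using that by (simp add: ratio D_xi_CMF[OF assms] D_q[OF assms])
    show "((\<lambda>\<alpha>. ereal (deriv (p_CMF d \<beta> a) \<alpha>)) \<longlongrightarrow>
        (if d \<le> 2 then \<infinity>
         else ereal (W0 (a * \<beta> * qbar d \<beta> 0) / (a * \<beta> * qbar d \<beta> 0) * rho_c d \<beta>))) (at_left 0)"
      unfolding ratio[OF order_refl] by (rule deriv_p_CMF_tendsto[OF assms])
  qed
qed

end
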